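(* Let $G$ be a finite group, $H$ a subgroup of $G$, $\mathcal{D}$ an admissible set of subgroups of $G$, and $p$ a prime divisor of $(G:H)$. Let $\mathcal{D}_{(H)}:=\mathcal{C}_{H}\cup(\mathcal{D}\setminus\mathcal{C}_{G})$ and let $\mathcal{D}_{(H,p)}$ be the set of $p$-Sylow subgroups of all elements of $\mathcal{D}_{(H)}$. Then $\operatorname{Sha}_{\mathcal{D}}^{2}(G,J_{G/H})[p^{\infty}]=\operatorname{Sha}_{\mathcal{D}_{(H,p)}}^{2}(G,J_{G/H})[p^{\infty}]$. In particular, $\operatorname{Sha}_{\omega}^{2}(G,J_{G/H})[p^{\infty}]=\operatorname{Sha}_{\mathcal{C}_{H,p}}^{2}(G,J_{G/H})[p^{\infty}]$, where $\mathcal{C}_{H,p}$ is the set of all cyclic subgroups of $H$ of $p$-power order.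
   Context: $\mathcal{C}_G$ (resp. $\mathcal{C}_H$) is the set of cyclic subgroups of $G$ (resp. $H$). $J_{G/H}$ is the cokernel of $\mathbb{Z}\to\operatorname{Ind}_H^G\mathbb{Z}=\mathrm{Hom}_{\mathbb{Z}[H]}(\mathbb{Z}[G],\mathbb{Z})$, $1\mapsto$ constant function $1$. $\operatorname{Sha}^2_{\mathcal{D}}(G,M):=\ker\big(H^2(G,M)\to\bigoplus_{D\in\mathcal{D}}H^2(D,M)\big)$; $\operatorname{Sha}^2_\omega$ is the case $\mathcal{D}=\mathcal{C}_G$. A finite set of subgroups is admissible if it contains all cyclic subgroups and is stable under conjugation. $A[p^\infty]$ is the $p$-primary torsion part. *)

theory Defs
  imports "HOL-Algebra.Product_Groups" "HOL-Computational_Algebra.Primes"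
begin

section \<open>Degree-two cohomology of a group with coefficients in a module\<close>

text \<open>
  A \<open>G\<close>-module is an abelian group \<open>M\<close>, written multiplicatively as everywhere in HOL-Algebra,
  with an action \<open>\<alpha>\<close> of \<open>G\<close> by group automorphisms.
\<close>

locale G_module = group G + M: comm_group M
  for G :: "('a, 'c) monoid_scheme" (structure) and M :: "('m, 'd) monoid_scheme"
    and \<alpha> :: "'a \<Rightarrow> 'm \<Rightarrow> 'm" +
  assumes act_hom: "g \<in> carrier G \<Longrightarrow> \<alpha> g \<in> hom M M"
    and act_one: "m \<in> carrier M \<Longrightarrow> \<alpha> \<one> m = m"
    and act_mult: "\<lbrakk>g \<in> carrier G; h \<in> carrier G; m \<in> carrier M\<rbrakk> \<Longrightarrow> \<alpha> (g \<otimes> h) m = \<alpha> g (\<alpha> h m)"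

text \<open>Inhomogeneous cochains of degree 1, 2, 3, with the differentials between them.\<close>

definition cochains1 :: "('a, 'c) monoid_scheme \<Rightarrow> ('m, 'd) monoid_scheme \<Rightarrow> ('a \<Rightarrow> 'm) monoid"
  where "cochains1 G M = product_group (carrier G) (\<lambda>_. M)"

definition cochains2 :: "('a, 'c) monoid_scheme \<Rightarrow> ('m, 'd) monoid_scheme \<Rightarrow> ('a \<times> 'a \<Rightarrow> 'm) monoid"
  where "cochains2 G M = product_group (carrier G \<times> carrier G) (\<lambda>_. M)"

definition cochains3 ::
    "('a, 'c) monoid_scheme \<Rightarrow> ('m, 'd) monoid_scheme \<Rightarrow> ('a \<times> 'a \<times> 'a \<Rightarrow> 'm) monoid"
  where "cochains3 G M = product_group (carrier G \<times> carrier G \<times> carrier G) (\<lambda>_. M)"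

definition coboundary1 ::
    "('a, 'c) monoid_scheme \<Rightarrow> ('m, 'd) monoid_scheme \<Rightarrow> ('a \<Rightarrow> 'm \<Rightarrow> 'm) \<Rightarrow>
     ('a \<Rightarrow> 'm) \<Rightarrow> ('a \<times> 'a \<Rightarrow> 'm)"
  where "coboundary1 G M \<alpha> f =
    (\<lambda>(g, h) \<in> carrier G \<times> carrier G.
       \<alpha> g (f h) \<otimes>\<^bsub>M\<^esub> inv\<^bsub>M\<^esub> f (g \<otimes>\<^bsub>G\<^esub> h) \<otimes>\<^bsub>M\<^esub> f g)"

definition coboundary2 ::
    "('a, 'c) monoid_scheme \<Rightarrow> ('m, 'd) monoid_scheme \<Rightarrow> ('a \<Rightarrow> 'm \<Rightarrow> 'm) \<Rightarrow>
     ('a \<times> 'a \<Rightarrow> 'm) \<Rightarrow> ('a \<times> 'a \<times> 'a \<Rightarrow> 'm)"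
  where "coboundary2 G M \<alpha> f =
    (\<lambda>(g, h, k) \<in> carrier G \<times> carrier G \<times> carrier G.
       \<alpha> g (f (h, k)) \<otimes>\<^bsub>M\<^esub> inv\<^bsub>M\<^esub> f (g \<otimes>\<^bsub>G\<^esub> h, k)
         \<otimes>\<^bsub>M\<^esub> f (g, h \<otimes>\<^bsub>G\<^esub> k) \<otimes>\<^bsub>M\<^esub> inv\<^bsub>M\<^esub> f (g, h))"

definition cocycles2 ::
    "('a, 'c) monoid_scheme \<Rightarrow> ('m, 'd) monoid_scheme \<Rightarrow> ('a \<Rightarrow> 'm \<Rightarrow> 'm) \<Rightarrow> ('a \<times> 'a \<Rightarrow> 'm) monoid"
  where "cocycles2 G M \<alpha> =
    (cochains2 G M)\<lparr>carrier := kernel (cochains2 G M) (cochains3 G M) (coboundary2 G M \<alpha>)\<rparr>"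

definition coboundaries2 ::
    "('a, 'c) monoid_scheme \<Rightarrow> ('m, 'd) monoid_scheme \<Rightarrow> ('a \<Rightarrow> 'm \<Rightarrow> 'm) \<Rightarrow> ('a \<times> 'a \<Rightarrow> 'm) set"
  where "coboundaries2 G M \<alpha> = coboundary1 G M \<alpha> ` carrier (cochains1 G M)"

definition cohomology2 ::
    "('a, 'c) monoid_scheme \<Rightarrow> ('m, 'd) monoid_scheme \<Rightarrow> ('a \<Rightarrow> 'm \<Rightarrow> 'm) \<Rightarrow>
     ('a \<times> 'a \<Rightarrow> 'm) set monoid"
  where "cohomology2 G M \<alpha> = cocycles2 G M \<alpha> Mod coboundaries2 G M \<alpha>"

text \<open>
  Restriction to a subgroup \<open>D\<close>, on classes. All representatives \<open>z\<close> of the class \<open>c\<close> give the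
  same coset, so that the union below is just that coset.
\<close>

definition restriction2 ::
    "('a, 'c) monoid_scheme \<Rightarrow> ('m, 'd) monoid_scheme \<Rightarrow> ('a \<Rightarrow> 'm \<Rightarrow> 'm) \<Rightarrow> 'a set \<Rightarrow>
     ('a \<times> 'a \<Rightarrow> 'm) set \<Rightarrow> ('a \<times> 'a \<Rightarrow> 'm) set"
  where "restriction2 G M \<alpha> D c =
    (\<Union>z\<in>c. coboundaries2 (G\<lparr>carrier := D\<rparr>) M \<alpha>
              #>\<^bsub>cocycles2 (G\<lparr>carrier := D\<rparr>) M \<alpha>\<^esub> restrict z (D \<times> D))"

section \<open>Families of subgroups and Tate--Shafarevich groups\<close>

definition cyclic_subgroups :: "('a, 'c) monoid_scheme \<Rightarrow> 'a set set"
  where "cyclic_subgroups G = {C. subgroup C G \<and> cyclic_group (G\<lparr>carrier := C\<rparr>)}"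

definition admissible :: "('a, 'c) monoid_scheme \<Rightarrow> 'a set set \<Rightarrow> bool"
  where "admissible G \<D> \<longleftrightarrow>
    finite \<D> \<and> (\<forall>D\<in>\<D>. subgroup D G) \<and> cyclic_subgroups G \<subseteq> \<D> \<and>
    (\<forall>g\<in>carrier G. \<forall>D\<in>\<D>. (\<lambda>x. g \<otimes>\<^bsub>G\<^esub> x \<otimes>\<^bsub>G\<^esub> inv\<^bsub>G\<^esub> g) ` D \<in> \<D>)"

definition sha2 ::
    "('a, 'c) monoid_scheme \<Rightarrow> 'a set set \<Rightarrow> ('m, 'd) monoid_scheme \<Rightarrow> ('a \<Rightarrow> 'm \<Rightarrow> 'm) \<Rightarrow>
     ('a \<times> 'a \<Rightarrow> 'm) set monoid"
  where "sha2 G \<D> M \<alpha> = (cohomology2 G M \<alpha>)\<lparr>carrier :=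
    kernel (cohomology2 G M \<alpha>)
           (sum_group \<D> (\<lambda>D. cohomology2 (G\<lparr>carrier := D\<rparr>) M \<alpha>))
           (\<lambda>c. \<lambda>D\<in>\<D>. restriction2 G M \<alpha> D c)\<rparr>"

definition sha2_omega ::
    "('a, 'c) monoid_scheme \<Rightarrow> ('m, 'd) monoid_scheme \<Rightarrow> ('a \<Rightarrow> 'm \<Rightarrow> 'm) \<Rightarrow>
     ('a \<times> 'a \<Rightarrow> 'm) set monoid"
  where "sha2_omega G M \<alpha> = sha2 G (cyclic_subgroups G) M \<alpha>"

definition primary_part :: "('a, 'c) monoid_scheme \<Rightarrow> nat \<Rightarrow> 'a set"
  where "primary_part A p = {a \<in> carrier A. \<exists>n::nat. a [^]\<^bsub>A\<^esub> (p ^ n) = \<one>\<^bsub>A\<^esub>}"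

text \<open>If \<open>p\<close> does not divide the order of \<open>K\<close>, the only \<open>p\<close>-Sylow subgroup is the trivial one.\<close>

definition sylow_subgroups :: "nat \<Rightarrow> ('a, 'c) monoid_scheme \<Rightarrow> 'a set set"
  where "sylow_subgroups p K = {P. subgroup P K \<and> card P = p ^ multiplicity p (order K)}"

definition family_at :: "('a, 'c) monoid_scheme \<Rightarrow> 'a set \<Rightarrow> 'a set set \<Rightarrow> 'a set set"
  where "family_at G H \<D> = cyclic_subgroups (G\<lparr>carrier := H\<rparr>) \<union> (\<D> - cyclic_subgroups G)"

definition family_at_prime :: "('a, 'c) monoid_scheme \<Rightarrow> 'a set \<Rightarrow> nat \<Rightarrow> 'a set set \<Rightarrow> 'a set set"
  where "family_at_prime G H p \<D> = (\<Union>D\<in>family_at G H \<D>. sylow_subgroups p (G\<lparr>carrier := D\<rparr>))"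

definition cyclic_p_subgroups :: "('a, 'c) monoid_scheme \<Rightarrow> nat \<Rightarrow> 'a set set"
  where "cyclic_p_subgroups K p = {C \<in> cyclic_subgroups K. \<exists>n::nat. card C = p ^ n}"

section \<open>The module $J_{G/H}$\<close>

text \<open>
  A homomorphism of left \<open>\<int>[H]\<close>-modules from \<open>\<int>[G]\<close> to the trivial module \<open>\<int>\<close> is identified with
  its restriction to the basis \<open>G\<close>, that is, with a function \<open>f\<close> on \<open>G\<close> such that \<open>f (h g) = f g\<close>
  for all \<open>h\<close> in \<open>H\<close>. The group \<open>G\<close> acts through right multiplication on \<open>\<int>[G]\<close>:
  \<open>(g f) (x) = f (x g)\<close>.
\<close>

definition Ind_int :: "('a, 'c) monoid_scheme \<Rightarrow> 'a set \<Rightarrow> ('a \<Rightarrow> int) monoid"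
  where "Ind_int G H = (product_group (carrier G) (\<lambda>_. integer_group))\<lparr>carrier :=
    {f \<in> carrier G \<rightarrow>\<^sub>E UNIV. \<forall>h\<in>H. \<forall>g\<in>carrier G. f (h \<otimes>\<^bsub>G\<^esub> g) = f g}\<rparr>"

definition Ind_act :: "('a, 'c) monoid_scheme \<Rightarrow> 'a \<Rightarrow> ('a \<Rightarrow> int) \<Rightarrow> ('a \<Rightarrow> int)"
  where "Ind_act G g f = (\<lambda>x\<in>carrier G. f (x \<otimes>\<^bsub>G\<^esub> g))"

definition const_map :: "('a, 'c) monoid_scheme \<Rightarrow> int \<Rightarrow> ('a \<Rightarrow> int)"
  where "const_map G n = (\<lambda>x\<in>carrier G. n)"

definition J :: "('a, 'c) monoid_scheme \<Rightarrow> 'a set \<Rightarrow> ('a \<Rightarrow> int) set monoid"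
  where "J G H = Ind_int G H Mod (const_map G ` carrier integer_group)"

text \<open>The action induced on the quotient: an element acts on a coset elementwise.\<close>

definition J_act :: "('a, 'c) monoid_scheme \<Rightarrow> 'a \<Rightarrow> ('a \<Rightarrow> int) set \<Rightarrow> ('a \<Rightarrow> int) set"
  where "J_act G g c = Ind_act G g ` c"

section \<open>Well-definedness\<close>

lemma (in group) Ind_comm_group: assumes "subgroup H G" shows "comm_group (Ind_int G H)"
proof -
  have HG: "h \<in> carrier G" if "h \<in> H" for h using subgroup.subset[OF assms] that by blast
  show ?thesis
  proof (rule comm_groupI)
    fix f assume "f \<in> carrier (Ind_int G H)"
    then show "\<exists>y\<in>carrier (Ind_int G H). y \<otimes>\<^bsub>Ind_int G H\<^esub> f = \<one>\<^bsub>Ind_int G H\<^esub>"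
      by (intro bexI[of _ "\<lambda>x\<in>carrier G. - f x"])
        (auto simp: Ind_int_def product_group_def integer_group_def HG)
  qed (auto simp: Ind_int_def product_group_def integer_group_def HG fun_eq_iff PiE_def extensional_def)
qed

lemma (in group) const_subgroup: assumes "subgroup H G"
  shows "subgroup (const_map G ` carrier integer_group) (Ind_int G H)"
proof -
  interpret I: comm_group "Ind_int G H" by (rule Ind_comm_group[OF assms])
  have HG: "h \<in> carrier G" if "h \<in> H" for h using subgroup.subset[OF assms] that by blast
  have inC: "const_map G n \<in> carrier (Ind_int G H)" for n
    by (auto simp: const_map_def Ind_int_def HG)
  have m: "const_map G n \<otimes>\<^bsub>Ind_int G H\<^esub> const_map G k = const_map G (n+k)" for n k
    by (auto simp: const_map_def Ind_int_def product_group_def integer_group_def)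
  have o: "\<one>\<^bsub>Ind_int G H\<^esub> = const_map G 0"
    by (auto simp: const_map_def Ind_int_def product_group_def integer_group_def)
  have iv: "inv\<^bsub>Ind_int G H\<^esub> const_map G n = const_map G (-n)" for n
    by (rule I.inv_equality) (use inC m o in auto)
  show ?thesis
    by (rule I.subgroupI) (use inC m o iv in auto)
qed

lemma (in group) J_comm_group: assumes "subgroup H G" shows "comm_group (J G H)"
  unfolding J_def using comm_group.abelian_FactGroup Ind_comm_group[OF assms] const_subgroup[OF assms] by blast

lemma (in group) Ind_act_hom: assumes "subgroup H G" "g \<in> carrier G"
  shows "Ind_act G g \<in> hom (Ind_int G H) (Ind_int G H)"
proof -
  have HG: "h \<in> carrier G" if "h \<in> H" for h using subgroup.subset[OF assms(1)] that by blast
  show ?thesis using assms(2)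
    by (auto simp: hom_def Ind_act_def Ind_int_def product_group_def integer_group_def HG m_assoc)
qed

lemma (in group) J_module: assumes H: "subgroup H G" shows "G_module G (J G H) (J_act G)"
proof -
  let ?N = "const_map G ` carrier integer_group"
  interpret I: comm_group "Ind_int G H" by (rule Ind_comm_group[OF H])
  interpret JJ: comm_group "J G H" by (rule J_comm_group[OF H])
  interpret N: normal ?N "Ind_int G H" using I.normal_iff_subgroup const_subgroup[OF H] by blast
  have Nact: "Ind_act G g ` ?N = ?N" if "g \<in> carrier G" for g
  proof -
    have "Ind_act G g (const_map G n) = const_map G n" for n
      using that by (auto simp: Ind_act_def const_map_def)
    then show ?thesis by (force simp: image_iff)
  qed
  have cos: "J_act G g (?N #>\<^bsub>Ind_int G H\<^esub> f) = ?N #>\<^bsub>Ind_int G H\<^esub> Ind_act G g f"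
    if "g \<in> carrier G" "f \<in> carrier (Ind_int G H)" for g f
  proof -
    have "J_act G g (?N #>\<^bsub>Ind_int G H\<^esub> f) = (\<Union>n\<in>?N. {Ind_act G g (n \<otimes>\<^bsub>Ind_int G H\<^esub> f)})"
      by (auto simp: J_act_def r_coset_def)
    also have "\<dots> = (\<Union>n\<in>?N. {Ind_act G g n \<otimes>\<^bsub>Ind_int G H\<^esub> Ind_act G g f})"
      using Ind_act_hom[OF H that(1)] that(2) N.subset by (intro SUP_cong refl) (auto simp: hom_def)
    also have "\<dots> = (\<Union>n\<in>Ind_act G g ` ?N. {n \<otimes>\<^bsub>Ind_int G H\<^esub> Ind_act G g f})" by auto
    also have "\<dots> = ?N #>\<^bsub>Ind_int G H\<^esub> Ind_act G g f" unfolding Nact[OF that(1)] r_coset_def ..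
    finally show ?thesis .
  qed
  have carJ: "\<exists>f\<in>carrier (Ind_int G H). c = ?N #>\<^bsub>Ind_int G H\<^esub> f" if "c \<in> carrier (J G H)" for c
    using that by (auto simp: J_def FactGroup_def RCOSETS_def)
  have inJ: "?N #>\<^bsub>Ind_int G H\<^esub> f \<in> carrier (J G H)" if "f \<in> carrier (Ind_int G H)" for f
    using that by (auto simp: J_def FactGroup_def RCOSETS_def)
  have mJ: "(?N #>\<^bsub>Ind_int G H\<^esub> f) \<otimes>\<^bsub>J G H\<^esub> (?N #>\<^bsub>Ind_int G H\<^esub> f') = ?N #>\<^bsub>Ind_int G H\<^esub> (f \<otimes>\<^bsub>Ind_int G H\<^esub> f')"
    if "f \<in> carrier (Ind_int G H)" "f' \<in> carrier (Ind_int G H)" for f f'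
    using N.rcos_sum[OF that] by (simp add: J_def FactGroup_def)
  have actI: "Ind_act G g f \<in> carrier (Ind_int G H)" if "g \<in> carrier G" "f \<in> carrier (Ind_int G H)" for g f
    using Ind_act_hom[OF H that(1)] that(2) by (auto simp: hom_def)
  have actm: "Ind_act G g (f \<otimes>\<^bsub>Ind_int G H\<^esub> f') = Ind_act G g f \<otimes>\<^bsub>Ind_int G H\<^esub> Ind_act G g f'" 
    if "g \<in> carrier G" "f \<in> carrier (Ind_int G H)" "f' \<in> carrier (Ind_int G H)" for g f f'
    using Ind_act_hom[OF H that(1)] that by (auto simp: hom_def)
  show ?thesis
  proof
    fix g assume g: "g \<in> carrier G"
    show "J_act G g \<in> hom (J G H) (J G H)"
    proof (rule homI)
      fix x assume "x \<in> carrier (J G H)"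
      then show "J_act G g x \<in> carrier (J G H)" using carJ cos g actI inJ by metis
    next
      fix x y assume x: "x \<in> carrier (J G H)" and y: "y \<in> carrier (J G H)"
      obtain a b where a: "a \<in> carrier (Ind_int G H)" "x = ?N #>\<^bsub>Ind_int G H\<^esub> a"
        and b: "b \<in> carrier (Ind_int G H)" "y = ?N #>\<^bsub>Ind_int G H\<^esub> b" using carJ[OF x] carJ[OF y] by blast
      show "J_act G g (x \<otimes>\<^bsub>J G H\<^esub> y) = J_act G g x \<otimes>\<^bsub>J G H\<^esub> J_act G g y"
        unfolding a b mJ[OF a(1) b(1)] using a b g
        by (simp add: cos mJ actI actm del: carrier_integer_group)
    qed
  next
    fix m assume "m \<in> carrier (J G H)"
    then obtain a where a: "a \<in> carrier (Ind_int G H)" "m = ?N #>\<^bsub>Ind_int G H\<^esub> a" using carJ by blast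
    have "Ind_act G \<one> a = a" using a(1) by (auto simp: Ind_act_def Ind_int_def fun_eq_iff PiE_def extensional_def)
    then show "J_act G \<one> m = m" using a cos by simp
  next
    fix g h m assume g: "g \<in> carrier G" and h: "h \<in> carrier G" and "m \<in> carrier (J G H)"
    then obtain a where a: "a \<in> carrier (Ind_int G H)" "m = ?N #>\<^bsub>Ind_int G H\<^esub> a" using carJ by blast
    have "Ind_act G (g \<otimes> h) a = Ind_act G g (Ind_act G h a)" using g h 
      by (auto simp: Ind_act_def m_assoc)
    then show "J_act G (g \<otimes> h) m = J_act G g (J_act G h m)" using a cos g h actI by simp
  qed
qed

context G_module begin

lemma comm_group_functions: "comm_group (product_group I (\<lambda>_. M))"
proof (rule group.group_comm_groupI)
  show "Group.group (product_group I (\<lambda>_. M))" by simp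
qed (auto simp: product_group_def intro!: restrict_ext M.m_comm)
lemma comm_cochains2: "comm_group (cochains2 G M)"
  by (simp add: cochains2_def comm_group_functions)
lemma comm_cochains1: "comm_group (cochains1 G M)"
  by (simp add: cochains1_def comm_group_functions)
lemma comm_cochains3: "comm_group (cochains3 G M)"
  by (simp add: cochains3_def comm_group_functions)


lemma act_closed[simp]: "g \<in> carrier G \<Longrightarrow> m \<in> carrier M \<Longrightarrow> \<alpha> g m \<in> carrier M"
  using act_hom by (auto simp: hom_def)
lemma act_distrib[simp]: "g \<in> carrier G \<Longrightarrow> m \<in> carrier M \<Longrightarrow> n \<in> carrier M \<Longrightarrow> \<alpha> g (m \<otimes>\<^bsub>M\<^esub> n) = \<alpha> g m \<otimes>\<^bsub>M\<^esub> \<alpha> g n"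
  using act_hom by (auto simp: hom_def)
lemma act_inv[simp]: "g \<in> carrier G \<Longrightarrow> m \<in> carrier M \<Longrightarrow> \<alpha> g (inv\<^bsub>M\<^esub> m) = inv\<^bsub>M\<^esub> (\<alpha> g m)"
  using act_hom group_hom.hom_inv[of M M "\<alpha> g" m] by (simp add: group_hom_def group_hom_axioms_def M.group_axioms)

lemma coboundary1_hom: "coboundary1 G M \<alpha> \<in> hom (cochains1 G M) (cochains2 G M)"
proof (rule homI)
  fix u v assume u: "u \<in> carrier (cochains1 G M)" and v: "v \<in> carrier (cochains1 G M)"
  have c: "u x \<in> carrier M" "v x \<in> carrier M" if "x \<in> carrier G" for x
    using u v that by (auto simp: cochains1_def)
  show "coboundary1 G M \<alpha> u \<in> carrier (cochains2 G M)"
    using c by (auto simp: coboundary1_def cochains2_def)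
  show "coboundary1 G M \<alpha> (u \<otimes>\<^bsub>cochains1 G M\<^esub> v) =
      coboundary1 G M \<alpha> u \<otimes>\<^bsub>cochains2 G M\<^esub> coboundary1 G M \<alpha> v"
    unfolding coboundary1_def cochains1_def cochains2_def product_group_def monoid.simps
    by (rule restrict_ext) (clarsimp simp: c M.inv_mult M.m_ac)
qed

lemma coboundary2_hom: "coboundary2 G M \<alpha> \<in> hom (cochains2 G M) (cochains3 G M)"
proof (rule homI)
  fix u v assume u: "u \<in> carrier (cochains2 G M)" and v: "v \<in> carrier (cochains2 G M)"
  have c: "u (x, y) \<in> carrier M" "v (x, y) \<in> carrier M" if "x \<in> carrier G" "y \<in> carrier G" for x y
    using u v that by (auto simp: cochains2_def)
  show "coboundary2 G M \<alpha> u \<in> carrier (cochains3 G M)"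
    using c by (auto simp: coboundary2_def cochains3_def)
  show "coboundary2 G M \<alpha> (u \<otimes>\<^bsub>cochains2 G M\<^esub> v) =
      coboundary2 G M \<alpha> u \<otimes>\<^bsub>cochains3 G M\<^esub> coboundary2 G M \<alpha> v"
    unfolding coboundary2_def cochains2_def cochains3_def product_group_def monoid.simps
    by (rule restrict_ext) (clarsimp simp: c M.inv_mult M.m_ac)
qed

lemma coboundary_cancel: assumes "a \<in> carrier M" "b \<in> carrier M" "c \<in> carrier M" "d \<in> carrier M" "e \<in> carrier M" "k \<in> carrier M"
  shows "(a \<otimes>\<^bsub>M\<^esub> inv\<^bsub>M\<^esub> b \<otimes>\<^bsub>M\<^esub> c) \<otimes>\<^bsub>M\<^esub> inv\<^bsub>M\<^esub> (a \<otimes>\<^bsub>M\<^esub> inv\<^bsub>M\<^esub> d \<otimes>\<^bsub>M\<^esub> e) \<otimes>\<^bsub>M\<^esub> (b \<otimes>\<^bsub>M\<^esub> inv\<^bsub>M\<^esub> d \<otimes>\<^bsub>M\<^esub> k) \<otimes>\<^bsub>M\<^esub> inv\<^bsub>M\<^esub> (c \<otimes>\<^bsub>M\<^esub> inv\<^bsub>M\<^esub> e \<otimes>\<^bsub>M\<^esub> k) = \<one>\<^bsub>M\<^esub>"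
  using M.r_inv[of "a \<otimes>\<^bsub>M\<^esub> (b \<otimes>\<^bsub>M\<^esub> (c \<otimes>\<^bsub>M\<^esub> (d \<otimes>\<^bsub>M\<^esub> (e \<otimes>\<^bsub>M\<^esub> k))))"] assms
  by (simp add: M.inv_mult M.m_ac del: M.r_inv M.l_inv M.Units_r_inv M.Units_l_inv)

lemma coboundary2_coboundary1: assumes "f \<in> carrier (cochains1 G M)" shows "coboundary2 G M \<alpha> (coboundary1 G M \<alpha> f) = \<one>\<^bsub>cochains3 G M\<^esub>"
proof -
  have f: "f x \<in> carrier M" if "x \<in> carrier G" for x using assms that by (auto simp: cochains1_def)
  show ?thesis unfolding coboundary2_def cochains3_def product_group_def
  proof (simp, rule restrict_ext, clarsimp)
    fix g h k assume *: "g \<in> carrier G" "h \<in> carrier G" "k \<in> carrier G"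
    show "\<alpha> g (coboundary1 G M \<alpha> f (h, k)) \<otimes>\<^bsub>M\<^esub> inv\<^bsub>M\<^esub> coboundary1 G M \<alpha> f (g \<otimes> h, k) \<otimes>\<^bsub>M\<^esub>
       coboundary1 G M \<alpha> f (g, h \<otimes> k) \<otimes>\<^bsub>M\<^esub> inv\<^bsub>M\<^esub> coboundary1 G M \<alpha> f (g, h) = \<one>\<^bsub>M\<^esub>"
      using * coboundary_cancel[of "\<alpha> g (\<alpha> h (f k))" "\<alpha> g (f (h \<otimes> k))" "\<alpha> g (f h)" "f (g \<otimes> (h \<otimes> k))" "f (g \<otimes> h)" "f g"] f
      by (simp add: coboundary1_def act_mult m_assoc)
  qed
qed

lemma comm_cocycles2: "comm_group (cocycles2 G M \<alpha>)"
proof -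
  interpret C2: comm_group "cochains2 G M" by (rule comm_cochains2)
  interpret C3: comm_group "cochains3 G M" by (rule comm_cochains3)
  interpret group_hom "cochains2 G M" "cochains3 G M" "coboundary2 G M \<alpha>" by unfold_locales (rule coboundary2_hom)
  show ?thesis unfolding cocycles2_def 
    by (rule group.group_comm_groupI[OF C2.subgroup_imp_group[OF subgroup_kernel]])
      (auto simp: kernel_def intro: C2.m_comm)
qed

lemma coboundaries2_sub: "subgroup (coboundaries2 G M \<alpha>) (cocycles2 G M \<alpha>)"
proof -
  interpret C1: comm_group "cochains1 G M" by (rule comm_cochains1)
  interpret C2: comm_group "cochains2 G M" by (rule comm_cochains2)
  interpret C3: comm_group "cochains3 G M" by (rule comm_cochains3)
  interpret d1: group_hom "cochains1 G M" "cochains2 G M" "coboundary1 G M \<alpha>" by unfold_locales (rule coboundary1_hom)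
  interpret d2: group_hom "cochains2 G M" "cochains3 G M" "coboundary2 G M \<alpha>" by unfold_locales (rule coboundary2_hom)
  show ?thesis unfolding coboundaries2_def cocycles2_def
    by (rule C2.subgroup_incl[OF d1.img_is_subgroup d2.subgroup_kernel]) (auto simp: kernel_def coboundary2_coboundary1)
qed

lemma comm_group_cohomology2: "comm_group (cohomology2 G M \<alpha>)"
  unfolding cohomology2_def using comm_group.abelian_FactGroup comm_cocycles2 coboundaries2_sub by blast

lemma G_module_subgroup: "subgroup D G \<Longrightarrow> G_module (G\<lparr>carrier := D\<rparr>) M \<alpha>"
  apply (intro G_module.intro subgroup_imp_group M.comm_group_axioms, assumption, unfold_locales)
  using act_hom act_one act_mult by (auto simp: subgroup.mem_carrier)

lemma restrict_cocycle2: assumes D: "subgroup D G" and z: "z \<in> carrier (cocycles2 G M \<alpha>)"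
  shows "restrict z (D \<times> D) \<in> carrier (cocycles2 (G\<lparr>carrier := D\<rparr>) M \<alpha>)"
proof -
  have D': "x \<in> carrier G" if "x \<in> D" for x using subgroup.mem_carrier[OF D that] .
  have Dm: "x \<otimes> y \<in> D" if "x \<in> D" "y \<in> D" for x y using subgroup.m_closed[OF D that] .
  from z have 1: "z \<in> carrier G \<times> carrier G \<rightarrow>\<^sub>E carrier M"
    and 2: "coboundary2 G M \<alpha> z = \<one>\<^bsub>cochains3 G M\<^esub>"
    by (auto simp: cocycles2_def kernel_def cochains2_def)
  have "coboundary2 (G\<lparr>carrier := D\<rparr>) M \<alpha> (restrict z (D \<times> D)) = restrict (coboundary2 G M \<alpha> z) (D \<times> D \<times> D)"
    unfolding coboundary2_def by (auto simp: fun_eq_iff D' Dm restrict_def)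
  then show ?thesis unfolding 2 using 1 D'
    by (auto simp: cocycles2_def kernel_def cochains2_def cochains3_def product_group_def fun_eq_iff restrict_def PiE_def Pi_def extensional_def)
qed

lemma restrict_coboundary2: assumes D: "subgroup D G" and z: "b \<in> coboundaries2 G M \<alpha>"
  shows "restrict b (D \<times> D) \<in> coboundaries2 (G\<lparr>carrier := D\<rparr>) M \<alpha>"
proof -
  have D': "x \<in> carrier G" if "x \<in> D" for x using subgroup.mem_carrier[OF D that] .
  have Dm: "x \<otimes> y \<in> D" if "x \<in> D" "y \<in> D" for x y using subgroup.m_closed[OF D that] .
  from z obtain f where f: "f \<in> carrier G \<rightarrow>\<^sub>E carrier M" "b = coboundary1 G M \<alpha> f" 
    by (auto simp: coboundaries2_def cochains1_def)
  have "restrict b (D \<times> D) = coboundary1 (G\<lparr>carrier := D\<rparr>) M \<alpha> (restrict f D)"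
    unfolding f coboundary1_def by (auto simp: fun_eq_iff D' Dm restrict_def)
  then show ?thesis unfolding coboundaries2_def using f(1) D'
    by (intro image_eqI[where x="restrict f D"]) (auto simp: cochains1_def)
qed

lemma restriction2_class: assumes D: "subgroup D G" and z: "z \<in> carrier (cocycles2 G M \<alpha>)"
  shows "restriction2 G M \<alpha> D (coboundaries2 G M \<alpha> #>\<^bsub>cocycles2 G M \<alpha>\<^esub> z) =
     coboundaries2 (G\<lparr>carrier := D\<rparr>) M \<alpha> #>\<^bsub>cocycles2 (G\<lparr>carrier := D\<rparr>) M \<alpha>\<^esub> restrict z (D \<times> D)" (is "_ = ?B #>\<^bsub>?Z\<^esub> _")
proof -
  interpret S: G_module "G\<lparr>carrier := D\<rparr>" M \<alpha> by (rule G_module_subgroup[OF D])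
  interpret Z: comm_group ?Z by (rule S.comm_cocycles2)
  have sB: "subgroup ?B ?Z" by (rule S.coboundaries2_sub)
  have D': "x \<in> carrier G" if "x \<in> D" for x using subgroup.mem_carrier[OF D that] .
  have m: "restrict (b \<otimes>\<^bsub>cocycles2 G M \<alpha>\<^esub> z) (D\<times>D) = restrict b (D\<times>D) \<otimes>\<^bsub>?Z\<^esub> restrict z (D\<times>D)" for b
    by (auto simp: cocycles2_def cochains2_def product_group_def fun_eq_iff restrict_def D')
  have e: "?B #>\<^bsub>?Z\<^esub> restrict (b \<otimes>\<^bsub>cocycles2 G M \<alpha>\<^esub> z) (D\<times>D) = ?B #>\<^bsub>?Z\<^esub> restrict z (D\<times>D)"
    if "b \<in> coboundaries2 G M \<alpha>" for b
  proof -
    have "restrict b (D\<times>D) \<in> ?B" using restrict_coboundary2[OF D that] .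
    then show ?thesis unfolding m using restrict_cocycle2[OF D z] sB
      
      using Z.coset_mult_assoc[OF subgroup.subset[OF sB] subgroup.mem_carrier[OF sB]] Z.coset_join2[OF subgroup.mem_carrier[OF sB] sB] by simp
  qed
  have "coboundaries2 G M \<alpha> \<noteq> {}" using coboundaries2_sub subgroup.one_closed by blast
  then show ?thesis unfolding restriction2_def r_coset_def[of "cocycles2 G M \<alpha>"]
    using e by auto
qed

end
end

theory Submission
  imports Defs "HOL-Algebra.Multiplicative_Group" "HOL-Algebra.Sylow"
begin

text \<open>
  A class of \<open>p\<close>-power order vanishes on \<open>D\<close> as soon as it vanishes on a \<open>p\<close>-Sylow
  subgroup of \<open>D\<close>, because the index annihilates it there. This settles the non-cyclic members of the
  family and reduces the cyclic ones to the case that \<open>D\<close> is a cyclic \<open>p\<close>-group. Then the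
  groups \<open>D \<inter> x\<inverse> H x\<close> form a chain; let \<open>C\<close> be the largest. Since \<open>C\<close> is
  conjugate to a cyclic \<open>p\<close>-subgroup of \<open>H\<close>, it is enough that restriction from
  \<open>D\<close> to \<open>C\<close> is injective on \<open>H\<^sup>2\<close> of \<open>J\<close>. In terms of
  \<open>H\<^sup>2(D, J) = J\<^sup>D / N\<^sub>D J\<close>, this says that an invariant of the form \<open>N\<^sub>C b\<close>
  is a norm from \<open>D\<close>. Lifted to an integral \<open>H\<close>-invariant function on \<open>G\<close>, such an element is still
  \<open>D\<close>-invariant, and its value at \<open>x\<close> is divisible by the order of \<open>D \<inter> x\<inverse> H x\<close>
  because that group is contained in \<open>C\<close>; this is exactly the condition for being a norm from \<open>D\<close>.
\<close>

section \<open>Factor sets and transfer\<close>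

text \<open>
  The cocycle and coboundary conditions are stated with all inverses moved to the other side, so that
  an identity following from them can be checked by multiplying equations and cancelling.
\<close>

definition factor_set ::
    "('a, 'c) monoid_scheme \<Rightarrow> ('m, 'd) monoid_scheme \<Rightarrow> ('a \<Rightarrow> 'm \<Rightarrow> 'm) \<Rightarrow> ('a \<times> 'a \<Rightarrow> 'm) \<Rightarrow> bool"
  where "factor_set G M \<alpha> z \<longleftrightarrow>
    z \<in> carrier G \<times> carrier G \<rightarrow> carrier M \<and>
    (\<forall>g\<in>carrier G. \<forall>h\<in>carrier G. \<forall>k\<in>carrier G.
       \<alpha> g (z (h, k)) \<otimes>\<^bsub>M\<^esub> z (g, h \<otimes>\<^bsub>G\<^esub> k) = z (g \<otimes>\<^bsub>G\<^esub> h, k) \<otimes>\<^bsub>M\<^esub> z (g, h))"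

definition splits ::
    "('a, 'c) monoid_scheme \<Rightarrow> ('m, 'd) monoid_scheme \<Rightarrow> ('a \<Rightarrow> 'm \<Rightarrow> 'm) \<Rightarrow> ('a \<times> 'a \<Rightarrow> 'm) \<Rightarrow> bool"
  where "splits G M \<alpha> z \<longleftrightarrow>
    (\<exists>f \<in> carrier G \<rightarrow> carrier M. \<forall>g\<in>carrier G. \<forall>h\<in>carrier G.
       z (g, h) \<otimes>\<^bsub>M\<^esub> f (g \<otimes>\<^bsub>G\<^esub> h) = \<alpha> g (f h) \<otimes>\<^bsub>M\<^esub> f g)"

lemma factor_set_subgroup:
  assumes "factor_set G M \<alpha> z" and "D \<subseteq> carrier G"
  shows "factor_set (G\<lparr>carrier := D\<rparr>) M \<alpha> z"
  using assms unfolding factor_set_def by (auto simp: Pi_def subset_iff)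

lemma splits_mono:
  assumes "splits G M \<alpha> z" and "D \<subseteq> carrier G"
  shows "splits (G\<lparr>carrier := D\<rparr>) M \<alpha> z"
  using assms unfolding splits_def by (fastforce simp: Pi_def subset_iff)

section \<open>Cancellation in groups and finite products in abelian groups\<close>

lemma (in group) inv_mult_cancel_left:
  assumes "x \<in> carrier G" "y \<in> carrier G"
  shows "inv x \<otimes> (x \<otimes> y) = y" "x \<otimes> (inv x \<otimes> y) = y"
  using assms by (simp_all add: m_assoc[symmetric])

text \<open>Multiplying known equations contributes equal factors to both sides, and these cancel.
  In the applications the balance premise comes down to commutativity and associativity, so the
  proof lies in the choice and orientation of the equations.\<close>

lemma (in comm_group) eq_by_balance2:
  assumes "a = b" "c = d" "x \<otimes> (a \<otimes> c) = y \<otimes> (b \<otimes> d)"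
    and "x \<in> carrier G" "y \<in> carrier G" "b \<in> carrier G" "d \<in> carrier G"
  shows "x = y"
  using assms by (metis m_closed right_cancel)

lemma (in comm_group) eq_by_balance4:
  assumes "a = b" "c = d" "e = f" "g = h"
    and "x \<otimes> (a \<otimes> (c \<otimes> (e \<otimes> g))) = y \<otimes> (b \<otimes> (d \<otimes> (f \<otimes> h)))"
    and "x \<in> carrier G" "y \<in> carrier G" "b \<in> carrier G" "d \<in> carrier G" "f \<in> carrier G" "h \<in> carrier G"
  shows "x = y"
  using assms by (metis m_closed right_cancel)

lemma (in comm_monoid) finprod_lessThan_Suc:
  assumes "\<And>i. i < Suc n \<Longrightarrow> f i \<in> carrier G"
  shows "finprod G f {..<Suc n} = f n \<otimes> finprod G f {..<n}"
  using assms by (simp add: lessThan_Suc Pi_def)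

lemma (in comm_group) hom_finprod:
  assumes "comm_group K" "h \<in> hom G K" "f \<in> A \<rightarrow> carrier G"
  shows "h (finprod G f A) = finprod K (\<lambda>x. h (f x)) A"
proof -
  interpret K: comm_group K by fact
  interpret h: group_hom G K h using assms(2) by unfold_locales
  show ?thesis
  proof (cases "finite A")
    case True
    then show ?thesis using assms(3)
      by (induction A rule: finite_induct) (auto simp: Pi_def)
  qed simp
qed

context G_module begin

lemma factor_setD:
  assumes "factor_set G M \<alpha> z"
  shows "\<lbrakk>g \<in> carrier G; h \<in> carrier G\<rbrakk> \<Longrightarrow> z (g, h) \<in> carrier M"
    and "\<lbrakk>g \<in> carrier G; h \<in> carrier G; k \<in> carrier G\<rbrakk> \<Longrightarrow>
      \<alpha> g (z (h, k)) \<otimes>\<^bsub>M\<^esub> z (g, h \<otimes> k) = z (g \<otimes> h, k) \<otimes>\<^bsub>M\<^esub> z (g, h)"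
  using assms unfolding factor_set_def by auto

text \<open>The cocycle identity at \<open>(g, \<one>, \<one>)\<close> and
  \<open>(\<one>, \<one>, g)\<close>. Cocycles are not normalised here, so
  \<open>z (\<one>, \<one>)\<close> is carried along in later formulas.\<close>

lemma factor_set_one:
  assumes z: "factor_set G M \<alpha> z" and g: "g \<in> carrier G"
  shows "z (g, \<one>) = \<alpha> g (z (\<one>, \<one>))" and "z (\<one>, g) = z (\<one>, \<one>)"
proof -
  have "\<alpha> g (z (\<one>, \<one>)) \<otimes>\<^bsub>M\<^esub> z (g, \<one>) = z (g, \<one>) \<otimes>\<^bsub>M\<^esub> z (g, \<one>)"
    using factor_setD(2)[OF z g one_closed one_closed] g by simp
  then show "z (g, \<one>) = \<alpha> g (z (\<one>, \<one>))" using g factor_setD(1)[OF z] by simp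
  have "z (\<one>, g) \<otimes>\<^bsub>M\<^esub> z (\<one>, g) = z (\<one>, g) \<otimes>\<^bsub>M\<^esub> z (\<one>, \<one>)"
    using factor_setD(2)[OF z one_closed one_closed g] g factor_setD(1)[OF z] by (simp add: act_one)
  then show "z (\<one>, g) = z (\<one>, \<one>)" using g factor_setD(1)[OF z] by simp
qed

lemma act_finprod:
  assumes "g \<in> carrier G" "f \<in> A \<rightarrow> carrier M"
  shows "\<alpha> g (finprod M f A) = finprod M (\<lambda>x. \<alpha> g (f x)) A"
  using assms by (intro M.hom_finprod M.comm_group_axioms act_hom)

lemma act_cancel:
  assumes "g \<in> carrier G" "m \<in> carrier M" "n \<in> carrier M" "\<alpha> g m = \<alpha> g n"
  shows "m = n"
  using assms act_mult[of "inv g" g] act_one by (metis inv_closed l_inv)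

text \<open>
  If \<open>z\<close> is the coboundary of \<open>\<phi>\<close> on \<open>P\<close>, extend \<open>\<phi>\<close> to \<open>f\<close> on \<open>G\<close> along coset representatives, in
  such a way that the corrected cocycle \<open>w\<close> is right \<open>P\<close>-invariant in its second argument. Summing
  the cocycle identity over \<open>G/P\<close> in the last variable then splits the multiple \<open>(G:P) z\<close>.
\<close>

lemma splits_pow_index:
  assumes fin: "finite (carrier G)" and P: "subgroup P G"
    and z: "factor_set G M \<alpha> z" and s: "splits (G\<lparr>carrier := P\<rparr>) M \<alpha> z"
  shows "splits G M \<alpha> (\<lambda>x. z x [^]\<^bsub>M\<^esub> (order G div card P))"
proof -
  interpret P: subgroup P G by fact
  note zc[simp] = factor_setD(1)[OF z]
  obtain \<phi> where \<phi>c: "\<And>q. q \<in> P \<Longrightarrow> \<phi> q \<in> carrier M"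
    and \<phi>: "\<And>q q'. q \<in> P \<Longrightarrow> q' \<in> P \<Longrightarrow> z (q, q') \<otimes>\<^bsub>M\<^esub> \<phi> (q \<otimes> q') = \<alpha> q (\<phi> q') \<otimes>\<^bsub>M\<^esub> \<phi> q"
    using s unfolding splits_def by auto
  \<comment> \<open>A representative of the left coset \<open>k P\<close>. The predicate under
    \<open>SOME\<close> depends on the coset only, which makes \<open>rep\<close> constant on
    it.\<close>
  define rep where "rep k = (SOME x. x \<in> carrier G \<and> inv k \<otimes> x \<in> P)" for k
  have rep0: "rep k \<in> carrier G \<and> inv k \<otimes> rep k \<in> P" if "k \<in> carrier G" for k
    unfolding rep_def by (rule someI[where x = k]) (use that in auto)
  have repc[simp]: "rep k \<in> carrier G" if "k \<in> carrier G" for k using rep0 that by blast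
  have repP: "inv (rep k) \<otimes> k \<in> P" if "k \<in> carrier G" for k
    using rep0[OF that] that P.m_inv_closed[of "inv k \<otimes> rep k"] by (auto simp: inv_mult_group)
  have rep_mult: "rep (k \<otimes> q) = rep k" if "k \<in> carrier G" "q \<in> P" for k q
  proof -
    have "inv (k \<otimes> q) \<otimes> x \<in> P \<longleftrightarrow> inv k \<otimes> x \<in> P" if x: "x \<in> carrier G" for x
    proof -
      have "inv (k \<otimes> q) \<otimes> x = inv q \<otimes> (inv k \<otimes> x)" "inv k \<otimes> x = q \<otimes> (inv (k \<otimes> q) \<otimes> x)"
        using x \<open>k \<in> carrier G\<close> \<open>q \<in> P\<close> by (auto simp: inv_mult_group m_assoc inv_mult_cancel_left)
      then show ?thesis using \<open>q \<in> P\<close> by (metis P.m_closed P.m_inv_closed)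
    qed
    then have "(\<lambda>x. x \<in> carrier G \<and> inv (k \<otimes> q) \<otimes> x \<in> P) = (\<lambda>x. x \<in> carrier G \<and> inv k \<otimes> x \<in> P)"
      by blast
    then show ?thesis by (simp add: rep_def)
  qed
  have rep_eqD: "inv k \<otimes> k' \<in> P" if "k \<in> carrier G" "k' \<in> carrier G" "rep k = rep k'" for k k'
  proof -
    have "inv k \<otimes> k' = (inv k \<otimes> rep k) \<otimes> (inv (rep k') \<otimes> k')"
      using that(1,2) unfolding that(3)[symmetric] by (simp add: m_assoc inv_mult_cancel_left)
    then show ?thesis using rep0[OF that(1)] repP[OF that(2)] by simp
  qed
  have rep_eqI: "rep k = rep k'" if "k \<in> carrier G" "k' \<in> carrier G" "inv k \<otimes> k' \<in> P" for k k'
    using rep_mult[OF that(1,3)] that(1,2) by (simp add: m_assoc[symmetric])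
  \<comment> \<open>The value that \<open>f_mult\<close>, taken at the representative
    \<open>rep g\<close>, forces at \<open>g\<close> when \<open>f\<close> is to be trivial on
    representatives.\<close>
  define f where "f g = \<alpha> (rep g) (\<phi> (inv (rep g) \<otimes> g)) \<otimes>\<^bsub>M\<^esub> inv\<^bsub>M\<^esub> z (rep g, inv (rep g) \<otimes> g)" for g
  have fc[simp]: "f g \<in> carrier M" if "g \<in> carrier G" for g
    using that repP[OF that] by (simp add: f_def \<phi>c)
  have f_eq: "f g \<otimes>\<^bsub>M\<^esub> z (rep g, inv (rep g) \<otimes> g) = \<alpha> (rep g) (\<phi> (inv (rep g) \<otimes> g))"
    if "g \<in> carrier G" for g
    using that repP[OF that] by (simp add: f_def \<phi>c M.m_assoc)
  have f_mult: "z (g, q) \<otimes>\<^bsub>M\<^esub> f (g \<otimes> q) = \<alpha> g (\<phi> q) \<otimes>\<^bsub>M\<^esub> f g" if g: "g \<in> carrier G" and q: "q \<in> P" for g q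
  proof -
    define r q1 where "r = rep g" and "q1 = inv r \<otimes> g"
    have rc[simp]: "r \<in> carrier G" and q1P: "q1 \<in> P" and gr: "g = r \<otimes> q1" and r2: "rep (g \<otimes> q) = r"
      and q2: "inv r \<otimes> (g \<otimes> q) = q1 \<otimes> q"
      using g q repP[OF g] rep_mult by (auto simp: r_def q1_def m_assoc[symmetric])
    note [simp] = P.mem_carrier[OF q1P] P.mem_carrier[OF q] \<phi>c[OF q] \<phi>c[OF q1P] \<phi>c[OF P.m_closed[OF q1P q]] g
    have e1: "f g \<otimes>\<^bsub>M\<^esub> z (r, q1) = \<alpha> r (\<phi> q1)"
      using f_eq[OF g] by (simp add: r_def q1_def)
    have e2: "f (g \<otimes> q) \<otimes>\<^bsub>M\<^esub> z (r, q1 \<otimes> q) = \<alpha> r (\<phi> (q1 \<otimes> q))"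
      using f_eq[of "g \<otimes> q"] r2 q2 by simp
    have e3: "\<alpha> r (z (q1, q)) \<otimes>\<^bsub>M\<^esub> \<alpha> r (\<phi> (q1 \<otimes> q)) = \<alpha> g (\<phi> q) \<otimes>\<^bsub>M\<^esub> \<alpha> r (\<phi> q1)"
      using arg_cong[OF \<phi>[OF q1P q], of "\<alpha> r"] by (simp add: gr act_mult)
    have e4: "\<alpha> r (z (q1, q)) \<otimes>\<^bsub>M\<^esub> z (r, q1 \<otimes> q) = z (g, q) \<otimes>\<^bsub>M\<^esub> z (r, q1)"
      using factor_setD(2)[OF z rc, of q1 q] by (simp add: gr)
    show ?thesis
      by (rule M.eq_by_balance4[OF e1 e2[symmetric] e3[symmetric] e4]) (simp_all add: M.m_ac)
  qed
  \<comment> \<open>Up to the factor \<open>f g\<close>, which does not involve \<open>k\<close>,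
    this is \<open>z\<close> divided by the coboundary of \<open>f\<close>. Dividing by
    \<open>f g\<close> as well would put the corrected cocycle in place of the original
    \<open>z (g, h)\<close> in the identity multiplied over \<open>R\<close> below.\<close>
  define w where "w g k = z (g, k) \<otimes>\<^bsub>M\<^esub> f (g \<otimes> k) \<otimes>\<^bsub>M\<^esub> inv\<^bsub>M\<^esub> \<alpha> g (f k)" for g k
  have wc[simp]: "w g k \<in> carrier M" if "g \<in> carrier G" "k \<in> carrier G" for g k
    using that by (simp add: w_def)
  have w_eq: "w g k \<otimes>\<^bsub>M\<^esub> \<alpha> g (f k) = z (g, k) \<otimes>\<^bsub>M\<^esub> f (g \<otimes> k)" if "g \<in> carrier G" "k \<in> carrier G" for g k
    using that by (simp add: w_def M.m_assoc)
  have w_mult: "w g (k \<otimes> q) = w g k" if g: "g \<in> carrier G" and k: "k \<in> carrier G" and q: "q \<in> P" for g k q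
  proof -
    note [simp] = P.mem_carrier[OF q] \<phi>c[OF q] g k
    have e1: "\<alpha> g (z (k, q)) \<otimes>\<^bsub>M\<^esub> \<alpha> g (f (k \<otimes> q)) = \<alpha> g (\<alpha> k (\<phi> q)) \<otimes>\<^bsub>M\<^esub> \<alpha> g (f k)"
      using arg_cong[OF f_mult[OF k q], of "\<alpha> g"] by simp
    have e2: "z (g \<otimes> k, q) \<otimes>\<^bsub>M\<^esub> f (g \<otimes> (k \<otimes> q)) = \<alpha> g (\<alpha> k (\<phi> q)) \<otimes>\<^bsub>M\<^esub> f (g \<otimes> k)"
      using f_mult[of "g \<otimes> k" q] q by (simp add: act_mult m_assoc)
    have e3: "\<alpha> g (z (k, q)) \<otimes>\<^bsub>M\<^esub> z (g, k \<otimes> q) = z (g \<otimes> k, q) \<otimes>\<^bsub>M\<^esub> z (g, k)"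
      using factor_setD(2)[OF z g k] by simp
    have e4: "w g (k \<otimes> q) \<otimes>\<^bsub>M\<^esub> \<alpha> g (f (k \<otimes> q)) \<otimes>\<^bsub>M\<^esub> (z (g, k) \<otimes>\<^bsub>M\<^esub> f (g \<otimes> k)) = 
       z (g, k \<otimes> q) \<otimes>\<^bsub>M\<^esub> f (g \<otimes> (k \<otimes> q)) \<otimes>\<^bsub>M\<^esub> (w g k \<otimes>\<^bsub>M\<^esub> \<alpha> g (f k))"
      using w_eq[OF g, of k] w_eq[OF g, of "k \<otimes> q"] by simp
    show ?thesis
      by (rule M.eq_by_balance4[OF e1 e2[symmetric] e3[symmetric] e4[symmetric]]) (simp_all add: M.m_ac)
  qed
  define R where "R = rep ` carrier G"
  have R: "R \<subseteq> carrier G" "finite R" using fin by (auto simp: R_def)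
  have rep_R: "rep r = r" if "r \<in> R" for r
    using that rep0 rep_eqI[of _ "rep _"] unfolding R_def by (metis (no_types, lifting) image_iff repc)
  have bij: "bij_betw (\<lambda>r. rep (h \<otimes> r)) R R" if h: "h \<in> carrier G" for h
  proof -
    have "inj_on (\<lambda>r. rep (h \<otimes> r)) R"
    proof (rule inj_onI)
      fix r r' assume r: "r \<in> R" "r' \<in> R" "rep (h \<otimes> r) = rep (h \<otimes> r')"
      then have c: "r \<in> carrier G" "r' \<in> carrier G" using R by auto
      have "inv (h \<otimes> r) \<otimes> (h \<otimes> r') = inv r \<otimes> r'"
        using c h by (simp add: inv_mult_group m_assoc inv_mult_cancel_left)
      then have "inv r \<otimes> r' \<in> P" using rep_eqD[OF _ _ r(3)] c h by simp
      then show "r = r'" using rep_eqI c rep_R r by metis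
    qed
    moreover have "(\<lambda>r. rep (h \<otimes> r)) ` R \<subseteq> R" using R h by (auto simp: R_def)
    ultimately show ?thesis using R(2) by (simp add: bij_betw_def endo_inj_surj)
  qed
  have "bij_betw (\<lambda>(r, q). r \<otimes> q) (R \<times> P) (carrier G)"
  proof (rule bij_betwI')
    fix x y assume "x \<in> R \<times> P" "y \<in> R \<times> P"
    then obtain r q r' q' where *: "x = (r, q)" "y = (r', q')" "r \<in> R" "q \<in> P" "r' \<in> R" "q' \<in> P" by auto
    then have c: "r \<in> carrier G" "r' \<in> carrier G" using R by auto
    have "r = r'" if "r \<otimes> q = r' \<otimes> q'" 
      using rep_mult[OF c(1) *(4)] rep_mult[OF c(2) *(6)] that rep_R * by metis
    then show "((case x of (r, q) \<Rightarrow> r \<otimes> q) = (case y of (r, q) \<Rightarrow> r \<otimes> q)) = (x = y)"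
      using * c by auto
  next
    fix x assume "x \<in> R \<times> P"
    then show "(case x of (r, q) \<Rightarrow> r \<otimes> q) \<in> carrier G" using R by auto
  next
    fix y assume y: "y \<in> carrier G"
    then show "\<exists>x\<in>R \<times> P. y = (case x of (r, q) \<Rightarrow> r \<otimes> q)"
      using repP[OF y] by (intro bexI[of _ "(rep y, inv (rep y) \<otimes> y)"])
        (auto simp: R_def m_assoc[symmetric])
  qed
  then have "card R * card P = order G" by (simp add: bij_betw_same_card[symmetric] order_def card_cartesian_product[symmetric])
  moreover have "card P > 0" using P.finite_imp_card_positive[OF fin] .
  ultimately have cardR: "order G div card P = card R" by (metis div_mult_self_is_m)
  define F where "F g = finprod M (w g) R" for g
  have Fc[simp]: "F g \<in> carrier M" if "g \<in> carrier G" for g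
    unfolding F_def using that R by (auto intro!: M.finprod_closed)
  \<comment> \<open>By \<open>w_mult\<close>, \<open>w g\<close> is constant on left cosets of
    \<open>P\<close>, so the product over \<open>R\<close> is one over \<open>G/P\<close>, which
    \<open>h\<close> permutes.\<close>
  have shift: "finprod M (\<lambda>k. w g (h \<otimes> k)) R = F g" if g: "g \<in> carrier G" and h: "h \<in> carrier G" for g h
  proof -
    have "w g (rep (h \<otimes> k)) = w g (h \<otimes> k)" if "k \<in> R" for k
    proof -
      have k: "h \<otimes> k \<in> carrier G" using that R h by auto
      then have "rep (h \<otimes> k) = h \<otimes> k \<otimes> (inv (h \<otimes> k) \<otimes> rep (h \<otimes> k))"
        by (simp add: m_assoc[symmetric])
      then show ?thesis using w_mult[OF g k] rep0[OF k] by metis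
    qed
    then have "finprod M (\<lambda>k. w g (h \<otimes> k)) R = finprod M (\<lambda>k. w g (rep (h \<otimes> k))) R"
      using R g h by (intro M.finprod_cong') auto
    also have "\<dots> = finprod M (w g) ((\<lambda>r. rep (h \<otimes> r)) ` R)"
      using bij[OF h] R g h by (subst M.finprod_reindex) (auto simp: bij_betw_def)
    also have "\<dots> = F g" using bij[OF h] by (simp add: bij_betw_def F_def)
    finally show ?thesis .
  qed
  have "z (g, h) [^]\<^bsub>M\<^esub> card R \<otimes>\<^bsub>M\<^esub> F (g \<otimes> h) = \<alpha> g (F h) \<otimes>\<^bsub>M\<^esub> F g"
    if g: "g \<in> carrier G" and h: "h \<in> carrier G" for g h
  proof -
    have "z (g, h) \<otimes>\<^bsub>M\<^esub> w (g \<otimes> h) k = \<alpha> g (w h k) \<otimes>\<^bsub>M\<^esub> w g (h \<otimes> k)" if "k \<in> R" for k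
    proof -
      have k: "k \<in> carrier G" using that R by auto
      note [simp] = g h k
      have e1: "\<alpha> g (w h k) \<otimes>\<^bsub>M\<^esub> \<alpha> g (\<alpha> h (f k)) = \<alpha> g (z (h, k)) \<otimes>\<^bsub>M\<^esub> \<alpha> g (f (h \<otimes> k))"
        using arg_cong[OF w_eq[OF h k], of "\<alpha> g"] by simp
      have e2: "w (g \<otimes> h) k \<otimes>\<^bsub>M\<^esub> \<alpha> g (\<alpha> h (f k)) = z (g \<otimes> h, k) \<otimes>\<^bsub>M\<^esub> f (g \<otimes> (h \<otimes> k))"
        using w_eq[of "g \<otimes> h" k] by (simp add: act_mult m_assoc)
      have e3: "w g (h \<otimes> k) \<otimes>\<^bsub>M\<^esub> \<alpha> g (f (h \<otimes> k)) = z (g, h \<otimes> k) \<otimes>\<^bsub>M\<^esub> f (g \<otimes> (h \<otimes> k))"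
        using w_eq[of g "h \<otimes> k"] by simp
      have e4: "\<alpha> g (z (h, k)) \<otimes>\<^bsub>M\<^esub> z (g, h \<otimes> k) = z (g \<otimes> h, k) \<otimes>\<^bsub>M\<^esub> z (g, h)"
        using factor_setD(2)[OF z g h k] .
      show ?thesis
        by (rule M.eq_by_balance4[OF e1 e2[symmetric] e3 e4]) (simp_all add: M.m_ac)
    qed
    then have "finprod M (\<lambda>k. z (g, h) \<otimes>\<^bsub>M\<^esub> w (g \<otimes> h) k) R = finprod M (\<lambda>k. \<alpha> g (w h k) \<otimes>\<^bsub>M\<^esub> w g (h \<otimes> k)) R"
      using R g h by (intro M.finprod_cong') (auto simp: subset_iff)
    moreover have "finprod M (\<lambda>k. z (g, h) \<otimes>\<^bsub>M\<^esub> w (g \<otimes> h) k) R = z (g, h) [^]\<^bsub>M\<^esub> card R \<otimes>\<^bsub>M\<^esub> F (g \<otimes> h)"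
      unfolding F_def using R g h
      by (subst M.finprod_multf) (auto simp: M.finprod_const subset_iff)
    moreover have "finprod M (\<lambda>k. \<alpha> g (w h k) \<otimes>\<^bsub>M\<^esub> w g (h \<otimes> k)) R = \<alpha> g (F h) \<otimes>\<^bsub>M\<^esub> F g"
      using R g h shift[OF g h] unfolding F_def
      by (subst M.finprod_multf) (auto simp: act_finprod subset_iff)
    ultimately show ?thesis by simp
  qed
  then show ?thesis unfolding splits_def cardR by (intro bexI[of _ F]) auto
qed

text \<open>Conjugation acts trivially on cohomology. Write \<open>c\<close> for conjugation by
  \<open>x\<close> and let \<open>K\<close> act through \<open>c\<close>: then
  \<open>z (c g, c h)\<close> and \<open>\<alpha> x (z (g, h))\<close> differ by the coboundary of
  the cochain \<open>z (x, g) / z (c g, x)\<close>. Correcting the given splitting by this cochain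
  and applying \<open>\<alpha> (inv x)\<close> splits \<open>z\<close> on \<open>K\<close>.\<close>

lemma splits_conjugate:
  assumes K: "subgroup K G" and x: "x \<in> carrier G" and z: "factor_set G M \<alpha> z"
    and s: "splits (G\<lparr>carrier := (\<lambda>g. x \<otimes> g \<otimes> inv x) ` K\<rparr>) M \<alpha> z"
  shows "splits (G\<lparr>carrier := K\<rparr>) M \<alpha> z"
proof -
  interpret K: subgroup K G by fact
  note zc[simp] = factor_setD(1)[OF z]
  define c where "c g = x \<otimes> g \<otimes> inv x" for g
  obtain \<phi> where \<phi>c: "\<And>g. g \<in> K \<Longrightarrow> \<phi> (c g) \<in> carrier M"
    and \<phi>: "\<And>g h. g \<in> K \<Longrightarrow> h \<in> K \<Longrightarrow> z (c g, c h) \<otimes>\<^bsub>M\<^esub> \<phi> (c g \<otimes> c h) = \<alpha> (c g) (\<phi> (c h)) \<otimes>\<^bsub>M\<^esub> \<phi> (c g)"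
    using s unfolding splits_def by (auto simp: c_def)
  have cc[simp]: "c g \<in> carrier G" if "g \<in> K" for g using that x by (simp add: c_def)
  have cx: "c g \<otimes> x = x \<otimes> g" if "g \<in> K" for g using that x by (simp add: c_def m_assoc)
  have cm: "c g \<otimes> c h = c (g \<otimes> h)" if "g \<in> K" "h \<in> K" for g h
    using that x by (simp add: c_def m_assoc inv_mult_cancel_left)
  define f where "f g = \<phi> (c g) \<otimes>\<^bsub>M\<^esub> z (x, g) \<otimes>\<^bsub>M\<^esub> inv\<^bsub>M\<^esub> z (c g, x)" for g
  have fc[simp]: "f g \<in> carrier M" if "g \<in> K" for g using that x \<phi>c by (simp add: f_def)
  have f_eq: "f g \<otimes>\<^bsub>M\<^esub> z (c g, x) = \<phi> (c g) \<otimes>\<^bsub>M\<^esub> z (x, g)" if "g \<in> K" for g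
    using that x \<phi>c by (simp add: f_def M.m_assoc)
  have f: "\<alpha> x (z (g, h)) \<otimes>\<^bsub>M\<^esub> f (g \<otimes> h) = \<alpha> (c g) (f h) \<otimes>\<^bsub>M\<^esub> f g" if g: "g \<in> K" and h: "h \<in> K" for g h
  proof -
    note [simp] = x g h \<phi>c
    have e1: "\<alpha> x (z (g, h)) \<otimes>\<^bsub>M\<^esub> z (x, g \<otimes> h) = z (x \<otimes> g, h) \<otimes>\<^bsub>M\<^esub> z (x, g)"
      using factor_setD(2)[OF z, of x g h] by simp
    have e2: "\<alpha> (c g) (z (x, h)) \<otimes>\<^bsub>M\<^esub> z (c g, x \<otimes> h) = z (x \<otimes> g, h) \<otimes>\<^bsub>M\<^esub> z (c g, x)"
      using factor_setD(2)[OF z, of "c g" x h] by (simp add: cx)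
    have e3: "\<alpha> (c g) (z (c h, x)) \<otimes>\<^bsub>M\<^esub> z (c g, x \<otimes> h) = z (c (g \<otimes> h), x) \<otimes>\<^bsub>M\<^esub> z (c g, c h)"
      using factor_setD(2)[OF z, of "c g" "c h" x] by (simp add: cx cm)
    have e4: "\<alpha> (c g) (f h) \<otimes>\<^bsub>M\<^esub> \<alpha> (c g) (z (c h, x)) = \<alpha> (c g) (\<phi> (c h)) \<otimes>\<^bsub>M\<^esub> \<alpha> (c g) (z (x, h))"
      using arg_cong[OF f_eq[OF h], of "\<alpha> (c g)"] by simp
    have e5: "z (c g, c h) \<otimes>\<^bsub>M\<^esub> \<phi> (c (g \<otimes> h)) = \<alpha> (c g) (\<phi> (c h)) \<otimes>\<^bsub>M\<^esub> \<phi> (c g)"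
      using \<phi>[OF g h] by (simp add: cm)
    have e6: "f (g \<otimes> h) \<otimes>\<^bsub>M\<^esub> z (c (g \<otimes> h), x) = \<phi> (c (g \<otimes> h)) \<otimes>\<^bsub>M\<^esub> z (x, g \<otimes> h)"
      using f_eq[of "g \<otimes> h"] by simp
    note e7 = f_eq[OF g]
    \<comment> \<open>Seven equations enter. Multiplying six of them in pairs, with
      \<open>e2\<close> reversed, leaves the four that \<open>eq_by_balance4\<close>
      accepts.\<close>
    have e12: "\<alpha> x (z (g, h)) \<otimes>\<^bsub>M\<^esub> z (x, g \<otimes> h) \<otimes>\<^bsub>M\<^esub> (z (x \<otimes> g, h) \<otimes>\<^bsub>M\<^esub> z (c g, x)) = 
      z (x \<otimes> g, h) \<otimes>\<^bsub>M\<^esub> z (x, g) \<otimes>\<^bsub>M\<^esub> (\<alpha> (c g) (z (x, h)) \<otimes>\<^bsub>M\<^esub> z (c g, x \<otimes> h))" unfolding e1 e2 ..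
    have e35: "\<alpha> (c g) (z (c h, x)) \<otimes>\<^bsub>M\<^esub> z (c g, x \<otimes> h) \<otimes>\<^bsub>M\<^esub> (z (c g, c h) \<otimes>\<^bsub>M\<^esub> \<phi> (c (g \<otimes> h))) =
      z (c (g \<otimes> h), x) \<otimes>\<^bsub>M\<^esub> z (c g, c h) \<otimes>\<^bsub>M\<^esub> (\<alpha> (c g) (\<phi> (c h)) \<otimes>\<^bsub>M\<^esub> \<phi> (c g))" unfolding e3 e5 ..
    have e47: "\<alpha> (c g) (f h) \<otimes>\<^bsub>M\<^esub> \<alpha> (c g) (z (c h, x)) \<otimes>\<^bsub>M\<^esub> (f g \<otimes>\<^bsub>M\<^esub> z (c g, x)) =
      \<alpha> (c g) (\<phi> (c h)) \<otimes>\<^bsub>M\<^esub> \<alpha> (c g) (z (x, h)) \<otimes>\<^bsub>M\<^esub> (\<phi> (c g) \<otimes>\<^bsub>M\<^esub> z (x, g))" unfolding e4 e7 ..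
    show ?thesis
      by (rule M.eq_by_balance4[OF e12[symmetric] e35[symmetric] e6[symmetric] e47]) (simp_all add: M.m_ac)
  qed
  define \<psi> where "\<psi> g = \<alpha> (inv x) (f g)" for g
  have \<psi>: "\<alpha> x (\<psi> g) = f g" "\<psi> g \<in> carrier M" if "g \<in> K" for g
    using that x act_mult[of x "inv x" "f g"] by (simp_all add: \<psi>_def act_one)
  have "z (g, h) \<otimes>\<^bsub>M\<^esub> \<psi> (g \<otimes> h) = \<alpha> g (\<psi> h) \<otimes>\<^bsub>M\<^esub> \<psi> g" if g: "g \<in> K" and h: "h \<in> K" for g h
  proof (rule act_cancel[OF x])
    have "\<alpha> x (\<alpha> g (\<psi> h)) = \<alpha> (c g) (f h)"
      using g h x \<psi>[OF h] act_mult[of x g "\<psi> h"] act_mult[of "c g" x "\<psi> h"] by (simp add: cx)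
    then show "\<alpha> x (z (g, h) \<otimes>\<^bsub>M\<^esub> \<psi> (g \<otimes> h)) = \<alpha> x (\<alpha> g (\<psi> h) \<otimes>\<^bsub>M\<^esub> \<psi> g)"
      using f[OF g h] g h x \<psi> by simp
  qed (use g h \<psi> in auto)
  then show ?thesis unfolding splits_def using \<psi> by (intro bexI[of _ \<psi>]) auto
qed

end

section \<open>Cyclic groups\<close>

lemma (in group) generate_eq_range_nat_pow:
  assumes "t \<in> carrier G" "ord t > 0"
  shows "generate G {t} = range (\<lambda>i::nat. t [^] i)"
  using generate_pow_nat[OF assms(1)] assms(2) by auto

lemma (in group) generate_bij_betw_nat_pow:
  assumes "t \<in> carrier G" "ord t > 0"
  shows "bij_betw (\<lambda>i::nat. t [^] i) {..<ord t} (generate G {t})"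
proof -
  have "{0..ord t - 1} = {..<ord t}" using assms(2) by auto
  then show ?thesis
    using ord_inj[OF assms(1)] ord_elems_inf_carrier[OF assms(1)] assms(2) generate_eq_range_nat_pow[OF assms]
    by (auto simp: bij_betw_def full_SetCompr_eq)
qed

context G_module begin

text \<open>At \<open>n = ord t\<close> this is the invariant that represents the class of
  \<open>z\<close> in \<open>H^2(<t>, M) = M^<t> / N M\<close>, and \<open>partial_norm\<close> is
  then the norm \<open>N u\<close>. Other values of \<open>n\<close> serve in the
  inductions.\<close>

abbreviation partial_sum :: "('a \<times> 'a \<Rightarrow> 'm) \<Rightarrow> 'a \<Rightarrow> nat \<Rightarrow> 'm"
  where "partial_sum z t n \<equiv> finprod M (\<lambda>j. z (t [^] j, t)) {..<n}"

abbreviation partial_norm :: "'m \<Rightarrow> 'a \<Rightarrow> nat \<Rightarrow> 'm"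
  where "partial_norm u t n \<equiv> finprod M (\<lambda>j. \<alpha> (t [^] j) u) {..<n}"

text \<open>The splitting relation with second argument \<open>t\<close> and value \<open>u\<close>
  at \<open>t\<close> forces a recursion along the powers of \<open>t\<close>. Hypothesis
  \<open>eq\<close> says that it closes up after \<open>ord t\<close> steps; induction on the second
  exponent then extends the relation to all powers.\<close>

lemma splits_cyclicI:
  assumes t: "t \<in> carrier G" and n: "ord t > 0" and z: "factor_set G M \<alpha> z"
    and u: "u \<in> carrier M" and eq: "partial_norm u t (ord t) = partial_sum z t (ord t)"
  shows "splits (G\<lparr>carrier := generate G {t}\<rparr>) M \<alpha> z"
proof -
  note [simp] = factor_setD(1)[OF z] t u
  define S where "S i = partial_norm u t i \<otimes>\<^bsub>M\<^esub> inv\<^bsub>M\<^esub> partial_sum z t i" for i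
  have Sc[simp]: "S i \<in> carrier M" for i by (simp add: S_def Pi_def)
  have S_Suc: "S (Suc i) = S i \<otimes>\<^bsub>M\<^esub> (\<alpha> (t [^] i) u \<otimes>\<^bsub>M\<^esub> inv\<^bsub>M\<^esub> z (t [^] i, t))" for i
    by (simp add: S_def M.finprod_lessThan_Suc M.inv_mult M.m_ac Pi_def)
  have S_per: "S (ord t + i) = S i" for i
  proof (induction i)
    case 0
    show ?case using eq by (simp add: S_def Pi_def)
  next
    case (Suc i)
    have "t [^] (ord t + i) = t [^] i" by (simp add: nat_pow_mult[symmetric])
    then show ?case using Suc by (simp add: S_Suc)
  qed
  have S_mod: "S i = S (i mod ord t)" for i
  proof -
    have "S (ord t * q + r) = S r" for q r
      using S_per by (induction q) (simp_all add: add.assoc)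
    from this[of "i div ord t" "i mod ord t"] show ?thesis by simp
  qed
  have S_eq: "S i = S j" if "t [^] i = t [^] j" for i j
  proof -
    have "int i mod int (ord t) = int j mod int (ord t)"
      using that int_pow_eq[of t "int j" "int i"] by (simp add: int_pow_int mod_eq_dvd_iff)
    then have "i mod ord t = j mod ord t" by (simp flip: zmod_int)
    then show ?thesis using S_mod[of i] S_mod[of j] by simp
  qed
  \<comment> \<open>The relation at the pair \<open>(\<one>, \<one>)\<close> allows only
    \<open>z (\<one>, \<one>)\<close> as value at \<open>\<one>\<close>, whence the leading factor.
    By \<open>S_eq\<close> the choice of exponent does not matter.\<close>
  define f where "f g = z (\<one>, \<one>) \<otimes>\<^bsub>M\<^esub> S (SOME i. g = t [^] i)" for g
  have f: "f (t [^] i) = z (\<one>, \<one>) \<otimes>\<^bsub>M\<^esub> S i" for i :: nat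
  proof -
    have "t [^] i = t [^] (SOME j::nat. t [^] i = t [^] j)" by (rule someI) (rule refl)
    from S_eq[OF this] show ?thesis by (simp add: f_def)
  qed
  have f_Suc: "f (t [^] Suc i) \<otimes>\<^bsub>M\<^esub> z (t [^] i, t) = f (t [^] i) \<otimes>\<^bsub>M\<^esub> \<alpha> (t [^] i) u" for i
    unfolding f S_Suc by (simp add: M.m_assoc)
  have fc[simp]: "f (t [^] i) \<in> carrier M" for i :: nat by (simp add: f)
  have [simp]: "f (t [^] i \<otimes> t) \<in> carrier M" for i :: nat using fc[of "Suc i"] by simp
  have "z (t [^] i, t [^] j) \<otimes>\<^bsub>M\<^esub> f (t [^] (i + j)) = \<alpha> (t [^] i) (f (t [^] j)) \<otimes>\<^bsub>M\<^esub> f (t [^] i)" for i j :: nat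
  proof (induction j)
    case 0
    show ?case using factor_set_one(1)[OF z, of "t [^] i"] f[of 0] by (simp add: S_def)
  next
    case (Suc j)
    have e1: "f (t [^] (i + Suc j)) \<otimes>\<^bsub>M\<^esub> z (t [^] (i + j), t) = f (t [^] (i + j)) \<otimes>\<^bsub>M\<^esub> \<alpha> (t [^] i) (\<alpha> (t [^] j) u)"
      using f_Suc[of "i + j"] by (simp add: nat_pow_mult[symmetric] act_mult)
    have e2: "\<alpha> (t [^] i) (f (t [^] Suc j)) \<otimes>\<^bsub>M\<^esub> \<alpha> (t [^] i) (z (t [^] j, t)) =
        \<alpha> (t [^] i) (f (t [^] j)) \<otimes>\<^bsub>M\<^esub> \<alpha> (t [^] i) (\<alpha> (t [^] j) u)"
      using arg_cong[OF f_Suc[of j], of "\<alpha> (t [^] i)"] by simp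
    have e3: "\<alpha> (t [^] i) (z (t [^] j, t)) \<otimes>\<^bsub>M\<^esub> z (t [^] i, t [^] Suc j) = z (t [^] (i + j), t) \<otimes>\<^bsub>M\<^esub> z (t [^] i, t [^] j)"
      using factor_setD(2)[OF z, of "t [^] i" "t [^] j" t] by (simp add: nat_pow_mult)
    show ?case
      by (rule M.eq_by_balance4[OF e1[symmetric] e2 e3[symmetric] Suc[symmetric]]) (simp_all add: M.m_ac del: add_Suc_right)
  qed
  then show ?thesis
    unfolding splits_def generate_eq_range_nat_pow[OF t n] by (intro bexI[of _ f]) (auto simp: nat_pow_mult)
qed

text \<open>The cocycle identities at \<open>(t^k, t^j, t)\<close> for \<open>j < i\<close>
  telescope; the two isolated values of \<open>z\<close> are the ends of the telescope.\<close>

lemma partial_sum_add: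
  assumes t: "t \<in> carrier G" and z: "factor_set G M \<alpha> z"
  shows "partial_sum z t (k + i) \<otimes>\<^bsub>M\<^esub> z (t [^] k, \<one>) =
    partial_sum z t k \<otimes>\<^bsub>M\<^esub> \<alpha> (t [^] k) (partial_sum z t i) \<otimes>\<^bsub>M\<^esub> z (t [^] k, t [^] i)"
proof (induction i)
  case 0
  show ?case using act_hom[of "t [^] k"] t hom_one[OF act_hom[of "t [^] k"] M.group_axioms M.group_axioms] factor_setD(1)[OF z]
    by (simp add: Pi_def)
next
  case (Suc i)
  note [simp] = factor_setD(1)[OF z] t Pi_def
  have e: "\<alpha> (t [^] k) (z (t [^] i, t)) \<otimes>\<^bsub>M\<^esub> z (t [^] k, t [^] Suc i) = z (t [^] (k + i), t) \<otimes>\<^bsub>M\<^esub> z (t [^] k, t [^] i)"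
    using factor_setD(2)[OF z, of "t [^] k" "t [^] i" t] by (simp add: nat_pow_mult)
  show ?case
    by (rule M.eq_by_balance2[OF e Suc[symmetric]]) (simp_all add: M.finprod_lessThan_Suc M.m_ac)
qed

text \<open>In the product of \<open>ord t + 1\<close> factors the first and the last are both
  \<open>z (\<one>, t)\<close>. Splitting off the last leaves \<open>partial_sum\<close>; splitting
  off the first leaves its image under \<open>t\<close>, by the addition formula.\<close>

lemma partial_sum_invariant:
  assumes t: "t \<in> carrier G" and z: "factor_set G M \<alpha> z"
  shows "\<alpha> t (partial_sum z t (ord t)) = partial_sum z t (ord t)"
proof -
  note [simp] = factor_setD(1)[OF z] t Pi_def
  have "partial_sum z t (Suc (ord t)) \<otimes>\<^bsub>M\<^esub> z (t, \<one>) =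
    z (\<one>, t) \<otimes>\<^bsub>M\<^esub> \<alpha> t (partial_sum z t (ord t)) \<otimes>\<^bsub>M\<^esub> z (t, \<one>)"
    using partial_sum_add[OF t z, of 1 "ord t"] M.finprod_lessThan_Suc[of 0 "\<lambda>j. z (t [^] j, t)"] by simp
  then show ?thesis by (simp add: M.finprod_lessThan_Suc)
qed

text \<open>The product of \<open>k * l\<close> factors is cut into \<open>l\<close> blocks of
  length \<open>k\<close>. By the addition formula, block \<open>m\<close> is the first one moved by
  \<open>s^m\<close>, up to values of \<open>z\<close> on \<open><s>\<close> that the splitting
  absorbs.\<close>

lemma partial_sum_eq_norm:
  assumes t: "t \<in> carrier G" and s: "s = t [^] k" and l: "ord t = k * l" and n: "ord s > 0" "s [^] l = \<one>"
    and z: "factor_set G M \<alpha> z" and split: "splits (G\<lparr>carrier := generate G {s}\<rparr>) M \<alpha> z"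
  obtains b where "b \<in> carrier M" "partial_sum z t (ord t) = partial_norm b s l"
proof -
  have sc: "s \<in> carrier G" using t s by simp
  note [simp] = factor_setD(1)[OF z] t sc Pi_def
  obtain \<phi> where \<phi>c[simp]: "\<And>i::nat. \<phi> (s [^] i) \<in> carrier M"
    and \<phi>: "\<And>i j::nat. z (s [^] i, s [^] j) \<otimes>\<^bsub>M\<^esub> \<phi> (s [^] (i + j)) = \<alpha> (s [^] i) (\<phi> (s [^] j)) \<otimes>\<^bsub>M\<^esub> \<phi> (s [^] i)"
    using split unfolding splits_def generate_eq_range_nat_pow[OF sc n(1)] by (auto simp: nat_pow_mult)
  have \<phi>s[simp]: "\<phi> s \<in> carrier M" and \<phi>1[simp]: "\<phi> \<one> \<in> carrier M" using \<phi>c[of 1] \<phi>c[of 0] by simp_all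
  \<comment> \<open>The first block, corrected by the splitting. The division by
    \<open>z (\<one>, \<one>)\<close> compensates the factor \<open>z (s^m, \<one>)\<close> that the
    addition formula produces.\<close>
  define b where "b = partial_sum z t k \<otimes>\<^bsub>M\<^esub> \<phi> s \<otimes>\<^bsub>M\<^esub> inv\<^bsub>M\<^esub> z (\<one>, \<one>)"
  have bc[simp]: "b \<in> carrier M" by (simp add: b_def)
  have b: "b \<otimes>\<^bsub>M\<^esub> z (\<one>, \<one>) = partial_sum z t k \<otimes>\<^bsub>M\<^esub> \<phi> s" by (simp add: b_def M.m_assoc)
  have "partial_sum z t (k * m) \<otimes>\<^bsub>M\<^esub> \<phi> (s [^] m) = \<phi> \<one> \<otimes>\<^bsub>M\<^esub> partial_norm b s m" for m
  proof (induction m)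
    case (Suc m)
    have e1: "partial_sum z t (k * Suc m) \<otimes>\<^bsub>M\<^esub> \<alpha> (s [^] m) (z (\<one>, \<one>)) =
      partial_sum z t (k * m) \<otimes>\<^bsub>M\<^esub> \<alpha> (s [^] m) (partial_sum z t k) \<otimes>\<^bsub>M\<^esub> z (s [^] m, s)"
      using partial_sum_add[OF t z, of "k * m" k] factor_set_one(1)[OF z, of "s [^] m"]
      by (simp add: s nat_pow_pow add.commute)
    have e2: "\<alpha> (s [^] m) b \<otimes>\<^bsub>M\<^esub> \<alpha> (s [^] m) (z (\<one>, \<one>)) = \<alpha> (s [^] m) (partial_sum z t k) \<otimes>\<^bsub>M\<^esub> \<alpha> (s [^] m) (\<phi> s)"
      using arg_cong[OF b, of "\<alpha> (s [^] m)"] by simp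
    have e3: "z (s [^] m, s) \<otimes>\<^bsub>M\<^esub> \<phi> (s [^] Suc m) = \<alpha> (s [^] m) (\<phi> s) \<otimes>\<^bsub>M\<^esub> \<phi> (s [^] m)"
      using \<phi>[of m 1] by simp
    have [simp]: "\<phi> (s [^] m \<otimes> s) \<in> carrier M" using \<phi>c[of "Suc m"] by simp
    show ?case
      by (rule M.eq_by_balance4[OF e1[symmetric] e2 e3[symmetric] Suc[symmetric]])
        (simp_all add: M.finprod_lessThan_Suc M.m_ac del: mult_Suc_right)
  qed simp
  from this[of l] have "partial_sum z t (ord t) = partial_norm b s l"
    using n l by (simp add: M.m_comm)
  then show ?thesis using that bc by blast
qed

end

section \<open>Norms in the module $J_{G/H}$\<close>

text \<open>Each right coset of \<open>K\<close> contributes \<open>card K\<close> times a value of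
  \<open>f\<close>.\<close>

lemma (in group) card_subgroup_dvd_sum_invariant:
  fixes f :: "'a \<Rightarrow> int"
  assumes fin: "finite (carrier G)" and K: "subgroup K G"
    and inv: "\<And>k c. k \<in> K \<Longrightarrow> c \<in> carrier G \<Longrightarrow> f (k \<otimes> c) = f c"
  shows "int (card K) dvd (\<Sum>c\<in>carrier G. f c)"
proof -
  interpret K: subgroup K G by fact
  have "(\<Sum>c\<in>carrier G. f c) = (\<Sum>c\<in>\<Union>(rcosets K). f c)"
    using rcosets_part_G[OF K] by simp
  also have "\<dots> = (\<Sum>Q\<in>rcosets K. sum f Q)"
    using fin rcosets_part_G[OF K] rcos_disjoint[OF K]
    by (subst sum.Union_disjoint) (auto simp: pairwise_def disjnt_def intro: rev_finite_subset)
  finally have eq: "(\<Sum>c\<in>carrier G. f c) = (\<Sum>Q\<in>rcosets K. sum f Q)" .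
  show ?thesis unfolding eq
  proof (rule dvd_sum)
    fix Q assume Q: "Q \<in> rcosets K"
    then obtain c where c: "c \<in> carrier G" "Q = K #> c" by (auto simp: RCOSETS_def)
    have "f q = f c" if "q \<in> Q" for q using that c inv by (auto simp: r_coset_def)
    then have "sum f Q = int (card Q) * f c" by simp
    then show "int (card K) dvd sum f Q" using card_rcosets_equal[OF Q] K.subset by simp
  qed
qed

lemma (in group) sum_subgroup_shift:
  assumes D: "subgroup D G" and d: "d \<in> D" and x: "x \<in> carrier G"
  shows "(\<Sum>c\<in>D. f (x \<otimes> d \<otimes> c)) = (\<Sum>c\<in>D. f (x \<otimes> c))"
proof -
  interpret D: subgroup D G by fact
  show ?thesis
    by (rule sum.reindex_bij_witness[where i = "\<lambda>c. inv d \<otimes> c" and j = "\<lambda>c. d \<otimes> c"])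
      (use d x in \<open>auto simp: m_assoc inv_mult_cancel_left\<close>)
qed

text \<open>
  On each double coset \<open>H x D\<close> the value of the sum over \<open>C\<close> is divisible by the order of
  \<open>D \<inter> x\<inverse> H x\<close>, since this group lies in \<open>C\<close>; hence it is a sum over \<open>D\<close> of a
  function supported on the single coset \<open>H x\<close>.
\<close>

lemma (in group) sum_subgroup_lift:
  fixes \<beta> :: "'a \<Rightarrow> int"
  assumes fin: "finite (carrier G)" and H: "subgroup H G" and D: "subgroup D G" and C: "subgroup C G"
    and \<beta>: "\<And>h g. h \<in> H \<Longrightarrow> g \<in> carrier G \<Longrightarrow> \<beta> (h \<otimes> g) = \<beta> g"
    and stab: "\<And>x d. x \<in> carrier G \<Longrightarrow> d \<in> D \<Longrightarrow> x \<otimes> d \<otimes> inv x \<in> H \<Longrightarrow> d \<in> C"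
    and A: "\<And>x d. x \<in> carrier G \<Longrightarrow> d \<in> D \<Longrightarrow> (\<Sum>c\<in>C. \<beta> (x \<otimes> d \<otimes> c)) = (\<Sum>c\<in>C. \<beta> (x \<otimes> c))"
  obtains \<gamma> :: "'a \<Rightarrow> int" where "\<And>h g. h \<in> H \<Longrightarrow> g \<in> carrier G \<Longrightarrow> \<gamma> (h \<otimes> g) = \<gamma> g"
    and "\<And>x. x \<in> carrier G \<Longrightarrow> (\<Sum>d\<in>D. \<gamma> (x \<otimes> d)) = (\<Sum>c\<in>C. \<beta> (x \<otimes> c))"
proof -
  interpret H: subgroup H G by fact
  interpret D: subgroup D G by fact
  interpret C: subgroup C G by fact
  define A where "A x = (\<Sum>c\<in>C. \<beta> (x \<otimes> c))" for x
  \<comment> \<open>The stabiliser in \<open>D\<close> of the coset \<open>H x\<close> under right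
    multiplication, that is, \<open>D \<inter> x^-1 H x\<close>.\<close>
  define K where "K x = {d \<in> D. x \<otimes> d \<otimes> inv x \<in> H}" for x
  have KC: "K x \<subseteq> C" if "x \<in> carrier G" for x using stab that by (auto simp: K_def)
  have K: "subgroup (K x) (G\<lparr>carrier := C\<rparr>)" if x: "x \<in> carrier G" for x
  proof -
    have "subgroup (K x) G"
    proof (rule subgroupI)
      fix a assume a: "a \<in> K x"
      then have "inv (x \<otimes> a \<otimes> inv x) \<in> H" by (auto simp: K_def)
      then show "inv a \<in> K x" using a x by (auto simp: K_def inv_mult_group m_assoc)
    next
      fix a b assume ab: "a \<in> K x" "b \<in> K x"
      then have "(x \<otimes> a \<otimes> inv x) \<otimes> (x \<otimes> b \<otimes> inv x) \<in> H" by (auto simp: K_def)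
      then show "a \<otimes> b \<in> K x" using ab x by (auto simp: K_def m_assoc inv_mult_cancel_left)
    next
      have "\<one> \<in> K x" using x by (auto simp: K_def)
      then show "K x \<noteq> {}" by auto
    qed (auto simp: K_def)
    then show ?thesis using KC[OF x] C by (intro subgroup_incl)
  qed
  \<comment> \<open>For \<open>k\<close> in \<open>K x\<close>, \<open>x k\<close> is an element of
    \<open>H\<close> times \<open>x\<close>, so the summand of \<open>A x\<close> is invariant under
    left multiplication by \<open>K x\<close>.\<close>
  have dvd: "int (card (K x)) dvd A x" if x: "x \<in> carrier G" for x
  proof -
    interpret CG: group "G\<lparr>carrier := C\<rparr>" by (rule subgroup_imp_group[OF C])
    have "\<beta> (x \<otimes> (k \<otimes> c)) = \<beta> (x \<otimes> c)" if "k \<in> K x" "c \<in> C" for k c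
    proof -
      have "x \<otimes> (k \<otimes> c) = (x \<otimes> k \<otimes> inv x) \<otimes> (x \<otimes> c)"
        using that x by (auto simp: K_def m_assoc inv_mult_cancel_left)
      then show ?thesis using \<beta>[of "x \<otimes> k \<otimes> inv x" "x \<otimes> c"] that x by (simp add: K_def)
    qed
    then show ?thesis
      using CG.card_subgroup_dvd_sum_invariant[OF _ K[OF x], of "\<lambda>c. \<beta> (x \<otimes> c)"] fin C.subset
      by (auto simp: A_def intro: rev_finite_subset)
  qed
  have AD: "A (x \<otimes> d) = A x" if "x \<in> carrier G" "d \<in> D" for x d using A that by (simp add: A_def)
  have AH: "A (h \<otimes> x) = A x" if "x \<in> carrier G" "h \<in> H" for x h
    unfolding A_def using that \<beta> by (intro sum.cong refl) (simp add: m_assoc)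
  define dc where "dc x = {h \<otimes> x \<otimes> d |h d. h \<in> H \<and> d \<in> D}" for x
  define rep where "rep x = (SOME y. y \<in> dc x)" for x
  have dc_eq: "dc (h \<otimes> x \<otimes> d) = dc x" if "x \<in> carrier G" "h \<in> H" "d \<in> D" for h x d
  proof (intro equalityI subsetI)
    fix y assume "y \<in> dc (h \<otimes> x \<otimes> d)"
    then obtain h' d' where *: "h' \<in> H" "d' \<in> D" "y = h' \<otimes> (h \<otimes> x \<otimes> d) \<otimes> d'" by (auto simp: dc_def)
    then have "y = (h' \<otimes> h) \<otimes> x \<otimes> (d \<otimes> d')" using that by (simp add: m_assoc)
    then show "y \<in> dc x" unfolding dc_def using * that by blast
  next
    fix y assume "y \<in> dc x"
    then obtain h' d' where *: "h' \<in> H" "d' \<in> D" "y = h' \<otimes> x \<otimes> d'" by (auto simp: dc_def)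
    then have "y = (h' \<otimes> inv h) \<otimes> (h \<otimes> x \<otimes> d) \<otimes> (inv d \<otimes> d')"
      using that by (simp add: m_assoc inv_mult_cancel_left)
    then show "y \<in> dc (h \<otimes> x \<otimes> d)" unfolding dc_def using * that by blast
  qed
  have rep_eq: "rep (h \<otimes> x) = rep x" "rep (x \<otimes> d) = rep x" if "x \<in> carrier G" "h \<in> H" "d \<in> D" for h x d
    using dc_eq[OF that(1,2) D.one_closed] dc_eq[OF that(1) H.one_closed that(3)] that by (simp_all add: rep_def)
  have rep: "\<exists>h\<in>H. \<exists>d\<in>D. x = h \<otimes> rep x \<otimes> d \<and> rep x \<in> carrier G" if x: "x \<in> carrier G" for x
  proof -
    have "x = \<one> \<otimes> x \<otimes> \<one>" using x by simp
    then have "x \<in> dc x" unfolding dc_def using H.one_closed D.one_closed by blast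
    then have "rep x \<in> dc x" unfolding rep_def by (rule someI)
    then obtain h d where *: "h \<in> H" "d \<in> D" "rep x = h \<otimes> x \<otimes> d" by (auto simp: dc_def)
    then have "x = inv h \<otimes> rep x \<otimes> inv d" "rep x \<in> carrier G" using x by (simp_all add: m_assoc inv_mult_cancel_left)
    then show ?thesis using * by blast
  qed
  \<comment> \<open>With \<open>y = rep g\<close>, an element \<open>y d\<close> lies in
    \<open>H y\<close> exactly when \<open>d\<close> is in \<open>K y\<close>. A sum over
    \<open>D\<close> therefore meets the support \<open>card (K y)\<close> times, which undoes the
    division.\<close>
  define \<gamma> where "\<gamma> g = (if g \<otimes> inv (rep g) \<in> H then A (rep g) div int (card (K (rep g))) else 0)" for g
  have repc: "rep x \<in> carrier G" if "x \<in> carrier G" for x using rep that by blast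
  have \<gamma>H: "\<gamma> (h \<otimes> g) = \<gamma> g" if "h \<in> H" "g \<in> carrier G" for h g
  proof -
    have "h \<otimes> g \<otimes> inv (rep g) \<in> H \<longleftrightarrow> g \<otimes> inv (rep g) \<in> H"
    proof
      assume "h \<otimes> g \<otimes> inv (rep g) \<in> H"
      then have "inv h \<otimes> (h \<otimes> g \<otimes> inv (rep g)) \<in> H" using that by simp
      then show "g \<otimes> inv (rep g) \<in> H" using that repc by (simp add: m_assoc inv_mult_cancel_left)
    qed (use that repc in \<open>simp add: m_assoc\<close>)
    then show ?thesis using rep_eq(1)[OF that(2,1) D.one_closed] by (simp add: \<gamma>_def)
  qed
  have \<gamma>D: "(\<Sum>d\<in>D. \<gamma> (x \<otimes> d)) = A x" if x: "x \<in> carrier G" for x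
  proof -
    define y where "y = rep x"
    obtain h d0 where *: "h \<in> H" "d0 \<in> D" "x = h \<otimes> y \<otimes> d0" and y: "y \<in> carrier G"
      using rep[OF x] unfolding y_def by blast
    have "rep (h \<otimes> y \<otimes> d0) = rep (h \<otimes> y)" by (rule rep_eq(2)[OF _ *(1,2)]) (use * y in simp)
    also have "\<dots> = rep y" by (rule rep_eq(1)[OF y *(1,2)])
    finally have ry: "rep y = y" using *(3) y_def by metis
    have "(\<Sum>d\<in>D. \<gamma> (x \<otimes> d)) = (\<Sum>d\<in>D. \<gamma> (h \<otimes> y \<otimes> d))"
      unfolding *(3) using * y by (intro sum_subgroup_shift D) auto
    also have "\<dots> = (\<Sum>d\<in>D. \<gamma> (y \<otimes> d))"
      using * y \<gamma>H by (intro sum.cong refl) (simp add: m_assoc)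
    also have "\<dots> = (\<Sum>d\<in>D. if y \<otimes> d \<otimes> inv y \<in> H then A y div int (card (K y)) else 0)"
      using rep_eq(2)[OF y H.one_closed] ry by (intro sum.cong refl) (simp add: \<gamma>_def)
    also have "\<dots> = int (card (K y)) * (A y div int (card (K y)))"
      using fin D.subset by (simp add: K_def sum.If_cases Int_def rev_finite_subset)
    also have "\<dots> = A y" using dvd[OF y] by simp
    also have "\<dots> = A x" using * y AD AH by simp
    finally show ?thesis .
  qed
  show ?thesis by (rule that[OF \<gamma>H]) (use \<gamma>D in \<open>auto simp: A_def\<close>)
qed

section \<open>The projection onto \<open>J_{G/H}\<close> and norms of projected functions\<close>

context group begin

abbreviation J_proj :: "'a set \<Rightarrow> ('a \<Rightarrow> int) \<Rightarrow> ('a \<Rightarrow> int) set"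
  where "J_proj H f \<equiv> (const_map G ` carrier integer_group) #>\<^bsub>Ind_int G H\<^esub> f"

lemma Ind_mult: "f \<otimes>\<^bsub>Ind_int G H\<^esub> f' = (\<lambda>x\<in>carrier G. f x + f' x)"
  by (simp add: Ind_int_def product_group_def integer_group_def)

lemma J_proj_hom: assumes "subgroup H G" shows "J_proj H \<in> hom (Ind_int G H) (J G H)"
proof -
  interpret I: comm_group "Ind_int G H" by (rule Ind_comm_group[OF assms])
  interpret N: normal "const_map G ` carrier integer_group" "Ind_int G H"
    using I.normal_iff_subgroup const_subgroup[OF assms] by blast
  show ?thesis unfolding J_def by (rule N.r_coset_hom_Mod)
qed

lemma J_act_proj:
  assumes g: "g \<in> carrier G"
  shows "J_act G g (J_proj H f) = J_proj H (Ind_act G g f)"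
proof -
  have "Ind_act G g (const_map G n \<otimes>\<^bsub>Ind_int G H\<^esub> f) = const_map G n \<otimes>\<^bsub>Ind_int G H\<^esub> Ind_act G g f" for n
    using g by (auto simp: Ind_mult Ind_act_def const_map_def)
  then show ?thesis by (simp add: J_act_def r_coset_def image_UN)
qed

lemma J_proj_eqD:
  assumes H: "subgroup H G" and f: "f \<in> carrier (Ind_int G H)" and eq: "J_proj H f = J_proj H f'"
  obtains e where "\<And>x. x \<in> carrier G \<Longrightarrow> f x = f' x + e"
proof -
  interpret I: comm_group "Ind_int G H" by (rule Ind_comm_group[OF H])
  have "f \<in> J_proj H f'" using I.rcos_self[OF f const_subgroup[OF H]] eq by simp
  then obtain n where "f = const_map G n \<otimes>\<^bsub>Ind_int G H\<^esub> f'" by (auto simp: r_coset_def)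
  then show ?thesis using that[of n] by (simp add: Ind_mult const_map_def)
qed

lemma finprod_Ind:
  assumes H: "subgroup H G" and "finite A" and "F \<in> A \<rightarrow> carrier (Ind_int G H)"
  shows "finprod (Ind_int G H) F A = (\<lambda>x\<in>carrier G. \<Sum>a\<in>A. F a x)"
proof -
  interpret I: comm_group "Ind_int G H" by (rule Ind_comm_group[OF H])
  show ?thesis using assms(2,3)
  proof (induction A rule: finite_induct)
    case empty
    have "\<one>\<^bsub>Ind_int G H\<^esub> = (\<lambda>x\<in>carrier G. 0)"
      by (simp add: Ind_int_def product_group_def integer_group_def)
    then show ?case by simp
  next
    case (insert a A)
    then show ?case by (auto simp: Ind_mult Pi_def)
  qed
qed

text \<open>Norms in \<open>J\<close> are computed on lifts. The powers \<open>t^j\<close> with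
  \<open>j < ord t\<close> run once through the generated group, so the product over exponents
  becomes an integral sum over group elements.\<close>

lemma J_norm_proj:
  assumes H: "subgroup H G" and t: "t \<in> carrier G" "ord t > 0" and f: "f \<in> carrier (Ind_int G H)"
  shows "finprod (J G H) (\<lambda>j. J_act G (t [^] j) (J_proj H f)) {..<ord t} =
    J_proj H (\<lambda>x\<in>carrier G. \<Sum>d\<in>generate G {t}. f (x \<otimes> d))"
proof -
  interpret I: comm_group "Ind_int G H" by (rule Ind_comm_group[OF H])
  have c: "Ind_act G (t [^] j) f \<in> carrier (Ind_int G H)" for j :: nat
    using Ind_act_hom[OF H, of "t [^] j"] t f by (auto simp: hom_def)
  have "(\<lambda>j. J_act G (t [^] j) (J_proj H f)) = (\<lambda>j::nat. J_proj H (Ind_act G (t [^] j) f))"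
    using J_act_proj t by simp
  then have "finprod (J G H) (\<lambda>j. J_act G (t [^] j) (J_proj H f)) {..<ord t} =
      J_proj H (finprod (Ind_int G H) (\<lambda>j. Ind_act G (t [^] j) f) {..<ord t})"
    using I.hom_finprod[OF J_comm_group[OF H] J_proj_hom[OF H], of "\<lambda>j. Ind_act G (t [^] j) f" "{..<ord t}"] c
    by simp
  also have "finprod (Ind_int G H) (\<lambda>j. Ind_act G (t [^] j) f) {..<ord t} =
      (\<lambda>x\<in>carrier G. \<Sum>j<ord t. Ind_act G (t [^] j) f x)"
    using c by (intro finprod_Ind H) auto
  also have "\<dots> = (\<lambda>x\<in>carrier G. \<Sum>d\<in>generate G {t}. f (x \<otimes> d))"
    by (rule restrict_ext) (simp add: Ind_act_def
        sum.reindex_bij_betw[OF generate_bij_betw_nat_pow[OF t], symmetric])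
  finally show ?thesis .
qed

text \<open>The sum \<open>A\<close> over \<open><s>\<close> of a lift of \<open>b\<close> is a lift
  of \<open>a\<close>. Once \<open>A\<close> is known to be invariant under \<open><t>\<close>
  exactly, not just up to constants, \<open>sum_subgroup_lift\<close> rewrites it as a sum over
  \<open><t>\<close>.\<close>

lemma J_norm_lift:
  assumes fin: "finite (carrier G)" and H: "subgroup H G" and t: "t \<in> carrier G" and sc: "s \<in> carrier G"
    and stab: "\<And>x d. x \<in> carrier G \<Longrightarrow> d \<in> generate G {t} \<Longrightarrow> x \<otimes> d \<otimes> inv x \<in> H \<Longrightarrow> d \<in> generate G {s}"
    and b: "b \<in> carrier (J G H)"
    and a: "a = finprod (J G H) (\<lambda>j. J_act G (s [^] j) b) {..<ord s}" and ta: "J_act G t a = a"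
  obtains u where "u \<in> carrier (J G H)" "finprod (J G H) (\<lambda>j. J_act G (t [^] j) u) {..<ord t} = a"
proof -
  let ?C = "generate G {s}" and ?D = "generate G {t}"
  have D: "subgroup ?D G" using t by (intro generate_is_subgroup) auto
  have C: "subgroup ?C G" using sc by (intro generate_is_subgroup) auto
  have ord: "ord g > 0" if "g \<in> carrier G" for g using ord_ge_1[OF fin that] by simp
  obtain \<beta> where \<beta>: "\<beta> \<in> carrier (Ind_int G H)" "b = J_proj H \<beta>"
    using b by (auto simp: J_def FactGroup_def RCOSETS_def)
  define A where "A = (\<lambda>x\<in>carrier G. \<Sum>c\<in>?C. \<beta> (x \<otimes> c))"
  have aA: "a = J_proj H A" unfolding a \<beta>(2) A_def by (rule J_norm_proj[OF H sc ord[OF sc] \<beta>(1)])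
  have HG: "h \<in> carrier G" if "h \<in> H" for h using H that subgroup.mem_carrier by metis
  have CG: "c \<in> carrier G" if "c \<in> ?C" for c using C that subgroup.mem_carrier by metis
  have DG: "d \<in> carrier G" if "d \<in> ?D" for d using D that subgroup.mem_carrier by metis
  have \<beta>H: "\<beta> (h \<otimes> g) = \<beta> g" if "h \<in> H" "g \<in> carrier G" for h g
    using \<beta>(1) that by (simp add: Ind_int_def)
  have A: "A \<in> carrier (Ind_int G H)"
    using \<beta>H HG CG by (auto simp: A_def Ind_int_def m_assoc)
  have "J_proj H (Ind_act G t A) = J_proj H A" using ta J_act_proj[OF t, of H A] aA by simp
  then obtain e where e0: "\<And>x. x \<in> carrier G \<Longrightarrow> Ind_act G t A x = A x + e"
    using J_proj_eqD[OF H, of "Ind_act G t A" A] Ind_act_hom[OF H t] A by (auto simp: hom_def)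
  then have e: "A (x \<otimes> t) = A x + e" if "x \<in> carrier G" for x using that by (simp add: Ind_act_def)
  have "A (x \<otimes> t [^] i) = A x + int i * e" if x: "x \<in> carrier G" for x and i :: nat
  proof (induction i)
    case (Suc i)
    then show ?case using e[of "x \<otimes> t [^] i"] x t by (simp add: m_assoc algebra_simps)
  qed (use x in simp)
  note At = this
  \<comment> \<open>After \<open>ord t\<close> translations \<open>A\<close> returns to itself, so
    \<open>ord t * e = 0\<close> in the integers. This is the vanishing of
    \<open>H^1(<t>, Z) = Hom(<t>, Z)\<close>.\<close>
  have "e = 0" using At[of \<one> "ord t"] ord[OF t] t by simp
  then have AD: "A (x \<otimes> d) = A x" if "x \<in> carrier G" "d \<in> ?D" for x d
    using At that unfolding generate_eq_range_nat_pow[OF t ord[OF t]] by auto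
  obtain \<gamma> :: "'a \<Rightarrow> int" where \<gamma>: "\<And>h g. h \<in> H \<Longrightarrow> g \<in> carrier G \<Longrightarrow> \<gamma> (h \<otimes> g) = \<gamma> g"
    "\<And>x. x \<in> carrier G \<Longrightarrow> (\<Sum>d\<in>?D. \<gamma> (x \<otimes> d)) = (\<Sum>c\<in>?C. \<beta> (x \<otimes> c))"
    by (rule sum_subgroup_lift[OF fin H D C, of \<beta>]) (use \<beta>H stab AD DG in \<open>auto simp: A_def\<close>)
  define g where "g = restrict \<gamma> (carrier G)"
  have g: "g \<in> carrier (Ind_int G H)" using \<gamma>(1) HG by (auto simp: g_def Ind_int_def)
  show ?thesis
  proof
    show "J_proj H g \<in> carrier (J G H)" using J_proj_hom[OF H] g by (auto simp: hom_def)
    have "(\<lambda>x\<in>carrier G. \<Sum>d\<in>?D. g (x \<otimes> d)) = A"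
      unfolding A_def by (rule restrict_ext) (simp add: \<gamma>(2)[symmetric] g_def DG)
    then show "finprod (J G H) (\<lambda>j. J_act G (t [^] j) (J_proj H g)) {..<ord t} = a"
      unfolding aA by (simp add: J_norm_proj[OF H t ord[OF t] g] del: carrier_integer_group)
  qed
qed

end

section \<open>Classes in terms of splitting factor sets\<close>

lemma splits_cong:
  assumes "\<And>g h. g \<in> carrier G \<Longrightarrow> h \<in> carrier G \<Longrightarrow> z (g, h) = z' (g, h)"
  shows "splits G M \<alpha> z \<longleftrightarrow> splits G M \<alpha> z'"
  using assms unfolding splits_def by simp

context G_module begin

section \<open>Torsion classes and Sylow subgroups\<close>

lemma act_pow:
  assumes "g \<in> carrier G" "m \<in> carrier M"
  shows "\<alpha> g (m [^]\<^bsub>M\<^esub> (n::nat)) = \<alpha> g m [^]\<^bsub>M\<^esub> n"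
  using assms by (induction n) (simp_all add: hom_one[OF act_hom M.group_axioms M.group_axioms])

text \<open>Bezout in the form \<open>a * x = b * y + 1\<close> makes \<open>z\<close> the quotient
  of its powers with exponents \<open>a * x\<close> and \<open>b * y\<close>, which is split by
  \<open>u^x / v^y\<close>.\<close>

lemma splits_coprime:
  assumes z: "factor_set G M \<alpha> z" and ab: "coprime a b" "a > 0"
    and sa: "splits G M \<alpha> (\<lambda>x. z x [^]\<^bsub>M\<^esub> (a::nat))" and sb: "splits G M \<alpha> (\<lambda>x. z x [^]\<^bsub>M\<^esub> (b::nat))"
  shows "splits G M \<alpha> z"
proof -
  note [simp] = factor_setD(1)[OF z]
  obtain x y where xy: "a * x = b * y + 1" using bezout_nat[of a b] ab by auto
  obtain u where [simp]: "\<And>g. g \<in> carrier G \<Longrightarrow> u g \<in> carrier M"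
    and u: "\<And>g h. g \<in> carrier G \<Longrightarrow> h \<in> carrier G \<Longrightarrow> z (g, h) [^]\<^bsub>M\<^esub> a \<otimes>\<^bsub>M\<^esub> u (g \<otimes> h) = \<alpha> g (u h) \<otimes>\<^bsub>M\<^esub> u g"
    using sa unfolding splits_def by auto
  obtain v where [simp]: "\<And>g. g \<in> carrier G \<Longrightarrow> v g \<in> carrier M"
    and v: "\<And>g h. g \<in> carrier G \<Longrightarrow> h \<in> carrier G \<Longrightarrow> z (g, h) [^]\<^bsub>M\<^esub> b \<otimes>\<^bsub>M\<^esub> v (g \<otimes> h) = \<alpha> g (v h) \<otimes>\<^bsub>M\<^esub> v g"
    using sb unfolding splits_def by auto
  define f where "f g = u g [^]\<^bsub>M\<^esub> x \<otimes>\<^bsub>M\<^esub> inv\<^bsub>M\<^esub> (v g [^]\<^bsub>M\<^esub> y)" for g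
  have fc[simp]: "f g \<in> carrier M" if "g \<in> carrier G" for g using that by (simp add: f_def)
  have f: "f g \<otimes>\<^bsub>M\<^esub> v g [^]\<^bsub>M\<^esub> y = u g [^]\<^bsub>M\<^esub> x" if "g \<in> carrier G" for g using that by (simp add: f_def M.m_assoc)
  have "z (g, h) \<otimes>\<^bsub>M\<^esub> f (g \<otimes> h) = \<alpha> g (f h) \<otimes>\<^bsub>M\<^esub> f g" if g: "g \<in> carrier G" and h: "h \<in> carrier G" for g h
  proof -
    note [simp] = g h
    have e1: "z (g, h) [^]\<^bsub>M\<^esub> (b * y) \<otimes>\<^bsub>M\<^esub> z (g, h) \<otimes>\<^bsub>M\<^esub> u (g \<otimes> h) [^]\<^bsub>M\<^esub> x = \<alpha> g (u h [^]\<^bsub>M\<^esub> x) \<otimes>\<^bsub>M\<^esub> u g [^]\<^bsub>M\<^esub> x"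
    proof -
      have "z (g, h) [^]\<^bsub>M\<^esub> (a * x) \<otimes>\<^bsub>M\<^esub> u (g \<otimes> h) [^]\<^bsub>M\<^esub> x = \<alpha> g (u h [^]\<^bsub>M\<^esub> x) \<otimes>\<^bsub>M\<^esub> u g [^]\<^bsub>M\<^esub> x"
        using arg_cong[OF u[OF g h], of "\<lambda>w. w [^]\<^bsub>M\<^esub> x"] by (simp add: M.nat_pow_distrib M.nat_pow_pow act_pow)
      then show ?thesis by (simp add: xy)
    qed
    have e2: "z (g, h) [^]\<^bsub>M\<^esub> (b * y) \<otimes>\<^bsub>M\<^esub> v (g \<otimes> h) [^]\<^bsub>M\<^esub> y = \<alpha> g (v h [^]\<^bsub>M\<^esub> y) \<otimes>\<^bsub>M\<^esub> v g [^]\<^bsub>M\<^esub> y"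
      using arg_cong[OF v[OF g h], of "\<lambda>w. w [^]\<^bsub>M\<^esub> y"] by (simp add: M.nat_pow_distrib M.nat_pow_pow act_pow)
    have e3: "\<alpha> g (f h) \<otimes>\<^bsub>M\<^esub> \<alpha> g (v h [^]\<^bsub>M\<^esub> y) = \<alpha> g (u h [^]\<^bsub>M\<^esub> x)"
      using arg_cong[OF f[OF h], of "\<alpha> g"] by simp
    have e4: "f g \<otimes>\<^bsub>M\<^esub> v g [^]\<^bsub>M\<^esub> y \<otimes>\<^bsub>M\<^esub> u (g \<otimes> h) [^]\<^bsub>M\<^esub> x = u g [^]\<^bsub>M\<^esub> x \<otimes>\<^bsub>M\<^esub> (f (g \<otimes> h) \<otimes>\<^bsub>M\<^esub> v (g \<otimes> h) [^]\<^bsub>M\<^esub> y)"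
      using f[OF g] f[of "g \<otimes> h"] by simp
    show ?thesis
      by (rule M.eq_by_balance4[OF e1[symmetric] e2 e3 e4]) (simp_all add: M.m_ac del: M.nat_pow_distrib)
  qed
  then show ?thesis unfolding splits_def by (intro bexI[of _ f]) auto
qed

text \<open>The class is annihilated by \<open>p ^ n\<close> and, by
  \<open>splits_pow_index\<close>, by the index of \<open>P\<close>, which is prime to
  \<open>p\<close>.\<close>

lemma splits_of_splits_sylow:
  assumes fin: "finite (carrier G)" and p: "Factorial_Ring.prime p" and z: "factor_set G M \<alpha> z"
    and pn: "splits G M \<alpha> (\<lambda>x. z x [^]\<^bsub>M\<^esub> (p ^ n))"
    and P: "subgroup P G" "card P = p ^ multiplicity p (order G)" and sP: "splits (G\<lparr>carrier := P\<rparr>) M \<alpha> z"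
  shows "splits G M \<alpha> z"
proof -
  have "order G \<noteq> 0" using fin by (auto simp: order_def)
  then have "\<not> p dvd order G div card P"
    using multiplicity_decompose[of "order G" p] p P(2) not_prime_unit by auto
  then have "coprime (p ^ n) (order G div card P)" using p by (simp add: prime_imp_coprime)
  then show ?thesis
    using splits_coprime[OF z _ _ pn splits_pow_index[OF fin P(1) z sP]] p by (simp add: prime_gt_0_nat)
qed

section \<open>Translation between cohomology classes and factor sets\<close>

lemma cocycle_factor_set:
  assumes "z \<in> carrier (cocycles2 G M \<alpha>)"
  shows "factor_set G M \<alpha> z"
proof -
  have c: "z (g, h) \<in> carrier M" if "g \<in> carrier G" "h \<in> carrier G" for g h
    using assms that by (auto simp: cocycles2_def kernel_def cochains2_def)
  have "\<alpha> g (z (h, k)) \<otimes>\<^bsub>M\<^esub> z (g, h \<otimes> k) = z (g \<otimes> h, k) \<otimes>\<^bsub>M\<^esub> z (g, h)"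
    if g: "g \<in> carrier G" "h \<in> carrier G" "k \<in> carrier G" for g h k
  proof -
    have "coboundary2 G M \<alpha> z (g, h, k) = \<one>\<^bsub>M\<^esub>"
      using assms g by (auto simp: cocycles2_def kernel_def cochains3_def)
    then have "\<alpha> g (z (h, k)) \<otimes>\<^bsub>M\<^esub> z (g, h \<otimes> k) \<otimes>\<^bsub>M\<^esub> inv\<^bsub>M\<^esub> (z (g \<otimes> h, k) \<otimes>\<^bsub>M\<^esub> z (g, h)) = \<one>\<^bsub>M\<^esub>"
      using g c by (simp add: coboundary2_def M.inv_mult M.m_ac)
    then show ?thesis using g c by (simp add: M.inv_solve_right')
  qed
  then show ?thesis using c by (auto simp: factor_set_def)
qed

lemma coboundary_iff_splits:
  assumes "z \<in> carrier (cocycles2 G M \<alpha>)"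
  shows "z \<in> coboundaries2 G M \<alpha> \<longleftrightarrow> splits G M \<alpha> z"
proof -
  note [simp] = factor_setD(1)[OF cocycle_factor_set[OF assms]]
  have ext: "z \<in> carrier G \<times> carrier G \<rightarrow>\<^sub>E carrier M"
    using assms by (auto simp: cocycles2_def kernel_def cochains2_def)
  have eq: "z (g, h) = \<alpha> g (f h) \<otimes>\<^bsub>M\<^esub> inv\<^bsub>M\<^esub> f (g \<otimes> h) \<otimes>\<^bsub>M\<^esub> f g \<longleftrightarrow>
      z (g, h) \<otimes>\<^bsub>M\<^esub> f (g \<otimes> h) = \<alpha> g (f h) \<otimes>\<^bsub>M\<^esub> f g"
    if f: "f \<in> carrier G \<rightarrow> carrier M" and g: "g \<in> carrier G" and h: "h \<in> carrier G" for f g h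
  proof -
    have [simp]: "f x \<in> carrier M" if "x \<in> carrier G" for x using f that by auto
    have "\<alpha> g (f h) \<otimes>\<^bsub>M\<^esub> inv\<^bsub>M\<^esub> f (g \<otimes> h) \<otimes>\<^bsub>M\<^esub> f g = (\<alpha> g (f h) \<otimes>\<^bsub>M\<^esub> f g) \<otimes>\<^bsub>M\<^esub> inv\<^bsub>M\<^esub> f (g \<otimes> h)"
      using g h by (simp add: M.m_ac)
    then show ?thesis using g h by (simp add: M.inv_solve_right)
  qed
  show ?thesis
  proof
    assume "z \<in> coboundaries2 G M \<alpha>"
    then obtain f where f: "f \<in> carrier G \<rightarrow>\<^sub>E carrier M" "z = coboundary1 G M \<alpha> f"
      by (auto simp: coboundaries2_def cochains1_def)
    then have "z (g, h) = \<alpha> g (f h) \<otimes>\<^bsub>M\<^esub> inv\<^bsub>M\<^esub> f (g \<otimes> h) \<otimes>\<^bsub>M\<^esub> f g" if "g \<in> carrier G" "h \<in> carrier G" for g h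
      using that by (simp add: coboundary1_def)
    moreover have "f \<in> carrier G \<rightarrow> carrier M" using f(1) by auto
    ultimately show "splits G M \<alpha> z" unfolding splits_def using eq by blast
  next
    assume "splits G M \<alpha> z"
    then obtain f where f: "f \<in> carrier G \<rightarrow> carrier M"
      and *: "\<And>g h. g \<in> carrier G \<Longrightarrow> h \<in> carrier G \<Longrightarrow> z (g, h) = \<alpha> g (f h) \<otimes>\<^bsub>M\<^esub> inv\<^bsub>M\<^esub> f (g \<otimes> h) \<otimes>\<^bsub>M\<^esub> f g"
      unfolding splits_def using eq by blast
    \<comment> \<open>Cochains are extensional, while a splitting is arbitrary off
      \<open>carrier G\<close>; hence the restriction.\<close>
    have "z = coboundary1 G M \<alpha> (restrict f (carrier G))"
    proof
      fix x
      show "z x = coboundary1 G M \<alpha> (restrict f (carrier G)) x"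
        using * ext by (cases x; cases "x \<in> carrier G \<times> carrier G")
          (auto simp: coboundary1_def PiE_def extensional_def)
    qed
    then show "z \<in> coboundaries2 G M \<alpha>"
      unfolding coboundaries2_def cochains1_def using f by (intro image_eqI) auto
  qed
qed

abbreviation cohomology_class :: "('a \<times> 'a \<Rightarrow> 'm) \<Rightarrow> ('a \<times> 'a \<Rightarrow> 'm) set"
  where "cohomology_class z \<equiv> coboundaries2 G M \<alpha> #>\<^bsub>cocycles2 G M \<alpha>\<^esub> z"

lemma class_eq_one_iff:
  assumes z: "z \<in> carrier (cocycles2 G M \<alpha>)"
  shows "cohomology_class z = \<one>\<^bsub>cohomology2 G M \<alpha>\<^esub> \<longleftrightarrow> splits G M \<alpha> z"
proof -
  interpret Z: comm_group "cocycles2 G M \<alpha>" by (rule comm_cocycles2)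
  show ?thesis
    using Z.coset_join1[OF _ z coboundaries2_sub] Z.coset_join2[OF z coboundaries2_sub] coboundary_iff_splits[OF z]
    by (auto simp: cohomology2_def FactGroup_def)
qed

lemma restriction2_eq_one_iff:
  assumes D: "subgroup D G" and z: "z \<in> carrier (cocycles2 G M \<alpha>)"
  shows "restriction2 G M \<alpha> D (cohomology_class z) = \<one>\<^bsub>cohomology2 (G\<lparr>carrier := D\<rparr>) M \<alpha>\<^esub> \<longleftrightarrow>
    splits (G\<lparr>carrier := D\<rparr>) M \<alpha> z"
proof -
  interpret S: G_module "G\<lparr>carrier := D\<rparr>" M \<alpha> by (rule G_module_subgroup[OF D])
  show ?thesis
    unfolding restriction2_class[OF D z] S.class_eq_one_iff[OF restrict_cocycle2[OF D z]]
    by (rule splits_cong) simp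
qed

lemma class_pow_eq_one_iff:
  assumes z: "z \<in> carrier (cocycles2 G M \<alpha>)"
  shows "cohomology_class z [^]\<^bsub>cohomology2 G M \<alpha>\<^esub> (n::nat) = \<one>\<^bsub>cohomology2 G M \<alpha>\<^esub> \<longleftrightarrow>
    splits G M \<alpha> (\<lambda>x. z x [^]\<^bsub>M\<^esub> n)"
proof -
  interpret Z: comm_group "cocycles2 G M \<alpha>" by (rule comm_cocycles2)
  interpret B: normal "coboundaries2 G M \<alpha>" "cocycles2 G M \<alpha>"
    using Z.normal_iff_subgroup coboundaries2_sub by blast
  have pow: "(z [^]\<^bsub>cocycles2 G M \<alpha>\<^esub> n) (g, h) = z (g, h) [^]\<^bsub>M\<^esub> n" if "g \<in> carrier G" "h \<in> carrier G" for g h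
    using that by (induction n) (simp_all add: cocycles2_def cochains2_def)
  have "cohomology_class z [^]\<^bsub>cohomology2 G M \<alpha>\<^esub> n = cohomology_class (z [^]\<^bsub>cocycles2 G M \<alpha>\<^esub> n)"
    unfolding cohomology2_def by (rule B.FactGroup_pow[OF z])
  moreover have "splits G M \<alpha> (z [^]\<^bsub>cocycles2 G M \<alpha>\<^esub> n) \<longleftrightarrow> splits G M \<alpha> (\<lambda>x. z x [^]\<^bsub>M\<^esub> n)"
    by (rule splits_cong) (rule pow)
  ultimately show ?thesis using class_eq_one_iff[OF Z.nat_pow_closed[OF z]] by simp
qed

lemma class_in_primary_sha2_iff:
  assumes \<D>: "\<And>D. D \<in> \<D> \<Longrightarrow> subgroup D G" and z: "z \<in> carrier (cocycles2 G M \<alpha>)"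
  shows "cohomology_class z \<in> primary_part (sha2 G \<D> M \<alpha>) p \<longleftrightarrow>
    (\<exists>n. splits G M \<alpha> (\<lambda>x. z x [^]\<^bsub>M\<^esub> (p ^ n))) \<and> (\<forall>D\<in>\<D>. splits (G\<lparr>carrier := D\<rparr>) M \<alpha> z)"
proof -
  have "cohomology_class z \<in> carrier (cohomology2 G M \<alpha>)"
    using z by (auto simp: cohomology2_def FactGroup_def RCOSETS_def)
  moreover have "(\<lambda>D\<in>\<D>. restriction2 G M \<alpha> D (cohomology_class z)) =
      (\<lambda>D\<in>\<D>. \<one>\<^bsub>cohomology2 (G\<lparr>carrier := D\<rparr>) M \<alpha>\<^esub>) \<longleftrightarrow> (\<forall>D\<in>\<D>. splits (G\<lparr>carrier := D\<rparr>) M \<alpha> z)"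
    using restriction2_eq_one_iff[OF \<D> z] by (auto simp: restrict_def fun_eq_iff)
  moreover have "c [^]\<^bsub>sha2 G \<D> M \<alpha>\<^esub> k = c [^]\<^bsub>cohomology2 G M \<alpha>\<^esub> k" for c and k :: nat
    by (simp add: sha2_def nat_pow_def)
  ultimately show ?thesis
    unfolding primary_part_def using class_pow_eq_one_iff[OF z] by (auto simp: sha2_def kernel_def)
qed

text \<open>Being \<open>p\<close>-power torsion is a condition common to both sides, so it may be
  assumed while the two families are compared on a single representative.\<close>

lemma primary_sha2_eqI:
  assumes \<D>: "\<And>D. D \<in> \<D> \<Longrightarrow> subgroup D G" and \<E>: "\<And>D. D \<in> \<E> \<Longrightarrow> subgroup D G"
    and eq: "\<And>z n. factor_set G M \<alpha> z \<Longrightarrow> splits G M \<alpha> (\<lambda>x. z x [^]\<^bsub>M\<^esub> (p ^ n)) \<Longrightarrow>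
      (\<forall>D\<in>\<D>. splits (G\<lparr>carrier := D\<rparr>) M \<alpha> z) \<longleftrightarrow> (\<forall>D\<in>\<E>. splits (G\<lparr>carrier := D\<rparr>) M \<alpha> z)"
  shows "primary_part (sha2 G \<D> M \<alpha>) p = primary_part (sha2 G \<E> M \<alpha>) p"
proof -
  have "c \<in> primary_part (sha2 G \<D> M \<alpha>) p \<longleftrightarrow> c \<in> primary_part (sha2 G \<E> M \<alpha>) p"
    if c: "c \<in> carrier (cohomology2 G M \<alpha>)" for c
  proof -
    obtain z where z: "z \<in> carrier (cocycles2 G M \<alpha>)" "c = cohomology_class z"
      using c by (auto simp: cohomology2_def FactGroup_def RCOSETS_def)
    then show ?thesis
      using eq[OF cocycle_factor_set[OF z(1)]] class_in_primary_sha2_iff[OF \<D> z(1)] class_in_primary_sha2_iff[OF \<E> z(1)]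
      by auto
  qed
  moreover have "primary_part (sha2 G \<F> M \<alpha>) p \<subseteq> carrier (cohomology2 G M \<alpha>)" for \<F>
    by (auto simp: primary_part_def sha2_def kernel_def)
  ultimately show ?thesis by blast
qed

end

section \<open>Restriction to cyclic subgroups of \<open>H\<close>\<close>

text \<open>The torsion hypothesis restricts to \<open>D\<close>, which then takes the place of the
  ambient group.\<close>

lemma (in G_module) splits_subgroup_of_splits_sylow:
  assumes fin: "finite (carrier G)" and p: "Factorial_Ring.prime p" and z: "factor_set G M \<alpha> z"
    and pn: "splits G M \<alpha> (\<lambda>x. z x [^]\<^bsub>M\<^esub> (p ^ n))"
    and D: "subgroup D G" and P: "P \<in> sylow_subgroups p (G\<lparr>carrier := D\<rparr>)"
    and sP: "splits (G\<lparr>carrier := P\<rparr>) M \<alpha> z"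
  shows "splits (G\<lparr>carrier := D\<rparr>) M \<alpha> z"
proof -
  interpret S: G_module "G\<lparr>carrier := D\<rparr>" M \<alpha> by (rule G_module_subgroup[OF D])
  have DG: "D \<subseteq> carrier G" by (rule subgroup.subset[OF D])
  show ?thesis
    by (rule S.splits_of_splits_sylow[OF _ p factor_set_subgroup[OF z DG] splits_mono[OF pn DG]])
      (use P sP fin DG in \<open>auto simp: sylow_subgroups_def intro: rev_finite_subset\<close>)
qed

context group begin

lemma subgroup_generate_singleton: "t \<in> carrier G \<Longrightarrow> subgroup (generate G {t}) G"
  by (simp add: generate_is_subgroup)

lemma generate_in_cyclic_subgroups:
  assumes "t \<in> carrier G"
  shows "generate G {t} \<in> cyclic_subgroups G"
  using cyclic_group_generated[of t] subgroup_generate_singleton[OF assms] assms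
  by (simp add: cyclic_subgroups_def subgroup_generated_def)

lemma cyclic_subgroupsE:
  assumes "C \<in> cyclic_subgroups G"
  obtains t where "t \<in> carrier G" "C = generate G {t}"
proof -
  have C: "subgroup C G" and "cyclic_group (G\<lparr>carrier := C\<rparr>)" using assms by (auto simp: cyclic_subgroups_def)
  then obtain t where t: "t \<in> C" "subgroup_generated (G\<lparr>carrier := C\<rparr>) {t} = G\<lparr>carrier := C\<rparr>"
    by (auto simp: cyclic_group_def)
  have "generate (G\<lparr>carrier := C\<rparr>) {t} = C"
    using arg_cong[OF t(2), of carrier] t(1) by (simp add: carrier_subgroup_generated)
  then have "C = generate G {t}" using generate_consistent[OF _ C, of "{t}"] t(1) by simp
  then show ?thesis using that t(1) subgroup.mem_carrier[OF C] by blast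
qed

lemma cyclic_subgroups_of_subgroup:
  assumes "subgroup H G" "C \<in> cyclic_subgroups (G\<lparr>carrier := H\<rparr>)"
  shows "C \<in> cyclic_subgroups G"
  using assms incl_subgroup[OF assms(1)] by (auto simp: cyclic_subgroups_def)

lemma nat_pow_conjugate:
  assumes "x \<in> carrier G" "s \<in> carrier G"
  shows "(x \<otimes> s \<otimes> inv x) [^] (i::nat) = x \<otimes> s [^] i \<otimes> inv x"
  using assms by (induction i) (simp_all add: m_assoc inv_mult_cancel_left)

lemma conjugate_generate:
  assumes fin: "finite (carrier G)" and x: "x \<in> carrier G" and s: "s \<in> carrier G"
  shows "(\<lambda>g. x \<otimes> g \<otimes> inv x) ` generate G {s} = generate G {x \<otimes> s \<otimes> inv x}"
proof -
  have "ord g > 0" if "g \<in> carrier G" for g using ord_ge_1[OF fin that] by simp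
  then show ?thesis using x s by (auto simp: generate_eq_range_nat_pow nat_pow_conjugate)
qed

text \<open>
  The stabilisers \<open>\<langle>t\<rangle> \<inter> x\<inverse> H x\<close> form a chain, since \<open>t\<close> has prime power
  order; \<open>s\<close> generates the largest one.
\<close>

lemma maximal_cyclic_stabilizer:
  assumes fin: "finite (carrier G)" and H: "subgroup H G" and p: "Factorial_Ring.prime p"
    and t: "t \<in> carrier G" and ord: "ord t = p ^ e"
  obtains x s v where "x \<in> carrier G" "s = t [^] (p ^ v :: nat)" "v \<le> e" "x \<otimes> s \<otimes> inv x \<in> H"
    "\<And>y d. y \<in> carrier G \<Longrightarrow> d \<in> generate G {t} \<Longrightarrow> y \<otimes> d \<otimes> inv y \<in> H \<Longrightarrow> d \<in> generate G {s}"
proof -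
  interpret H: subgroup H G by fact
  \<comment> \<open>A smaller \<open>v\<close> means a larger subgroup, so the least
    \<open>v\<close> with a conjugate of \<open>t^(p^v)\<close> in \<open>H\<close> gives the
    largest stabiliser. Such exponents exist, since \<open>v = e\<close> gives the identity.\<close>
  define Q where "Q v \<longleftrightarrow> (\<exists>x\<in>carrier G. x \<otimes> t [^] (p ^ v :: nat) \<otimes> inv x \<in> H)" for v
  define v where "v = (LEAST v. Q v)"
  have "t [^] (p ^ e :: nat) = \<one>" using pow_ord_eq_1[OF t] ord by simp
  then have Qe: "Q e" unfolding Q_def by (intro bexI[of _ \<one>]) auto
  have Qv: "Q v" and ve: "v \<le> e" unfolding v_def by (rule LeastI[of Q, OF Qe], rule Least_le[of Q, OF Qe])
  obtain x where x: "x \<in> carrier G" "x \<otimes> t [^] (p ^ v :: nat) \<otimes> inv x \<in> H" using Qv by (auto simp: Q_def)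
  define s where "s = t [^] (p ^ v :: nat)"
  have sc: "s \<in> carrier G" using t by (simp add: s_def)
  have ordp: "ord g > 0" if "g \<in> carrier G" for g using ord_ge_1[OF fin that] by simp
  show ?thesis
  proof (rule that[of x s v])
    fix y d assume y: "y \<in> carrier G" and d: "d \<in> generate G {t}" and yd: "y \<otimes> d \<otimes> inv y \<in> H"
    obtain i :: nat where i: "d = t [^] i" using d generate_eq_range_nat_pow[OF t ordp[OF t]] by auto
    have "p ^ v dvd i"
    proof (cases "i = 0")
      case False
      then obtain m where m: "i = p ^ multiplicity p i * m" "\<not> p dvd m"
        using multiplicity_decompose'[of i p] not_prime_unit p by blast
      define w where "w = multiplicity p i"
      \<comment> \<open>As \<open>m\<close> is invertible modulo \<open>ord t = p ^ e\<close>, some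
        power of \<open>d\<close> equals \<open>t^(p^w)\<close>. Hence \<open>y\<close> also
        conjugates \<open>t^(p^w)\<close> into \<open>H\<close>, and minimality gives
        \<open>v \<le> w\<close>.\<close>
      have "coprime m (p ^ e)" using p m(2) by (metis coprime_commute coprime_power_right_iff prime_imp_coprime)
      moreover have "m \<noteq> 0" using m(2) by (metis dvd_0_right)
      ultimately obtain j q where jq: "m * j = p ^ e * q + 1" using bezout_nat[of m "p ^ e"] by auto
      have "i * j = p ^ w * (m * j)" using m(1) unfolding w_def by (metis mult.assoc)
      then have "d [^] j = t [^] (p ^ w * (m * j))" unfolding i nat_pow_pow[OF t] by (rule arg_cong)
      also have "p ^ w * (m * j) = ord t * (p ^ w * q) + p ^ w" unfolding jq ord by (simp add: algebra_simps)
      also have "t [^] (ord t * (p ^ w * q) + p ^ w) = t [^] (ord t * (p ^ w * q)) \<otimes> t [^] (p ^ w)"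
        using t by (simp add: nat_pow_mult)
      also have "t [^] (ord t * (p ^ w * q)) = \<one>" using t by (simp add: pow_eq_id)
      finally have dj: "d [^] j = t [^] (p ^ w)" using t by simp
      have "(y \<otimes> d \<otimes> inv y) [^] j \<in> H" using yd H by (metis H.subgroup_axioms subgroup_int_pow_closed int_pow_int)
      then have "Q w" using nat_pow_conjugate[of y d j] y t by (auto simp: Q_def i dj[unfolded i])
      then have "v \<le> w" unfolding v_def by (rule Least_le)
      then have "p ^ v dvd p ^ w" by (rule le_imp_power_dvd)
      then show ?thesis using m(1) by (metis dvd_mult2 w_def)
    qed simp
    then obtain r where "i = p ^ v * r" by blast
    then have "d = s [^] r" using t by (simp add: i s_def nat_pow_pow)
    then show "d \<in> generate G {s}" using generate_eq_range_nat_pow[OF sc ordp[OF sc]] by auto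
  qed (use x ve s_def in auto)
qed

text \<open>A conjugate of the largest stabiliser \<open><s>\<close> is a cyclic
  \<open>p\<close>-subgroup \<open>K\<close> of \<open>H\<close>. Splitting passes from
  \<open>K\<close> to \<open><s>\<close>, so the invariant attached to \<open>t\<close> is a norm
  from \<open><s>\<close>; \<open>J_norm_lift\<close> makes it a norm from \<open><t>\<close>, which
  is what \<open>splits_cyclicI\<close> requires.\<close>

lemma splits_J_generate:
  assumes fin: "finite (carrier G)" and H: "subgroup H G" and p: "Factorial_Ring.prime p"
    and z: "factor_set G (J G H) (J_act G) z"
    and split: "\<And>K. K \<in> cyclic_p_subgroups (G\<lparr>carrier := H\<rparr>) p \<Longrightarrow> splits (G\<lparr>carrier := K\<rparr>) (J G H) (J_act G) z"
    and t: "t \<in> carrier G" and ord: "ord t = p ^ e"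
  shows "splits (G\<lparr>carrier := generate G {t}\<rparr>) (J G H) (J_act G) z"
proof -
  interpret JM: G_module G "J G H" "J_act G" by (rule J_module[OF H])
  have ordp: "ord g > 0" if "g \<in> carrier G" for g using ord_ge_1[OF fin that] by simp
  obtain x s v where x: "x \<in> carrier G" and s: "s = t [^] (p ^ v :: nat)" and ve: "v \<le> e" and xs: "x \<otimes> s \<otimes> inv x \<in> H"
    and stab: "\<And>y d. y \<in> carrier G \<Longrightarrow> d \<in> generate G {t} \<Longrightarrow> y \<otimes> d \<otimes> inv y \<in> H \<Longrightarrow> d \<in> generate G {s}"
    using maximal_cyclic_stabilizer[OF fin H p t ord] by metis
  have sc: "s \<in> carrier G" using t s by simp
  have ords: "ord s = p ^ (e - v)"
    using ord_pow[OF t, of "p ^ v"] p ve by (simp add: s ord le_imp_power_dvd power_diff prime_gt_0_nat)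
  have n: "ord t = p ^ v * ord s" using ve by (simp add: ord ords flip: power_add)
  define K where "K = generate G {x \<otimes> s \<otimes> inv x}"
  have K: "K = (\<lambda>g. x \<otimes> g \<otimes> inv x) ` generate G {s}" using conjugate_generate[OF fin x sc] by (simp add: K_def)
  have "inj_on (\<lambda>g. x \<otimes> g \<otimes> inv x) (generate G {s})"
    using x subgroup.mem_carrier[OF subgroup_generate_singleton[OF sc]] by (intro inj_onI) simp
  then have "card K = p ^ (e - v)" using generate_pow_card[OF sc] ords by (simp add: K card_image)
  moreover have "K \<in> cyclic_subgroups (G\<lparr>carrier := H\<rparr>)"
  proof -
    interpret HG: group "G\<lparr>carrier := H\<rparr>" by (rule subgroup_imp_group[OF H])
    have "K = generate (G\<lparr>carrier := H\<rparr>) {x \<otimes> s \<otimes> inv x}"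
      unfolding K_def using generate_consistent[OF _ H] xs by simp
    then show ?thesis using HG.generate_in_cyclic_subgroups xs by simp
  qed
  ultimately have "splits (G\<lparr>carrier := K\<rparr>) (J G H) (J_act G) z"
    by (intro split) (auto simp: cyclic_p_subgroups_def)
  then have "splits (G\<lparr>carrier := generate G {s}\<rparr>) (J G H) (J_act G) z"
    unfolding K by (rule JM.splits_conjugate[OF subgroup_generate_singleton[OF sc] x z])
  then obtain b where b: "b \<in> carrier (J G H)" "JM.partial_sum z t (ord t) = JM.partial_norm b s (ord s)"
    using JM.partial_sum_eq_norm[OF t s n ordp[OF sc] pow_ord_eq_1[OF sc] z] by blast
  obtain u where "u \<in> carrier (J G H)" "JM.partial_norm u t (ord t) = JM.partial_sum z t (ord t)"
    by (rule J_norm_lift[OF fin H t sc stab b JM.partial_sum_invariant[OF t z]])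
  then show ?thesis by (rule JM.splits_cyclicI[OF t ordp[OF t] z])
qed

text \<open>The torsion hypothesis reduces \<open>D\<close> to its \<open>p\<close>-Sylow subgroup,
  which is again cyclic and falls under \<open>splits_J_generate\<close>.\<close>

lemma splits_J_cyclic:
  assumes fin: "finite (carrier G)" and H: "subgroup H G" and p: "Factorial_Ring.prime p"
    and z: "factor_set G (J G H) (J_act G) z"
    and pn: "splits G (J G H) (J_act G) (\<lambda>x. z x [^]\<^bsub>J G H\<^esub> (p ^ n))"
    and split: "\<And>K. K \<in> cyclic_p_subgroups (G\<lparr>carrier := H\<rparr>) p \<Longrightarrow> splits (G\<lparr>carrier := K\<rparr>) (J G H) (J_act G) z"
    and D: "D \<in> cyclic_subgroups G"
  shows "splits (G\<lparr>carrier := D\<rparr>) (J G H) (J_act G) z"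
proof -
  interpret JM: G_module G "J G H" "J_act G" by (rule J_module[OF H])
  obtain t where t: "t \<in> carrier G" "D = generate G {t}" using cyclic_subgroupsE[OF D] .
  have ordp: "ord t > 0" using ord_ge_1[OF fin t(1)] by simp
  define k where "k = multiplicity p (ord t)"
  obtain m where m: "ord t = p ^ k * m" using multiplicity_dvd[of p "ord t"] by (auto simp: k_def)
  have m0: "m \<noteq> 0" using m ordp by auto
  \<comment> \<open>\<open>m\<close> is the part of \<open>ord t\<close> prime to \<open>p\<close>,
    so \<open>s\<close> generates the \<open>p\<close>-Sylow subgroup of \<open>D\<close>.\<close>
  define s where "s = t [^] m"
  have sc: "s \<in> carrier G" using t by (simp add: s_def)
  have ords: "ord s = p ^ k" using ord_pow[OF t(1), of m] m m0 by (simp add: s_def)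
  have "s \<in> D" using generate_eq_range_nat_pow[OF t(1) ordp] by (auto simp: t(2) s_def)
  have Dsub: "subgroup D G" unfolding t(2) by (rule subgroup_generate_singleton[OF t(1)])
  have "generate G {s} \<in> sylow_subgroups p (G\<lparr>carrier := D\<rparr>)"
    using generate_pow_card[OF sc] generate_pow_card[OF t(1)] ords
      subgroup_incl[OF subgroup_generate_singleton[OF sc] Dsub generate_subgroup_incl[OF _ Dsub]] \<open>s \<in> D\<close>
    by (simp add: sylow_subgroups_def order_def k_def t(2))
  then show ?thesis
    using JM.splits_subgroup_of_splits_sylow[OF fin p z pn Dsub] splits_J_generate[OF fin H p z split sc ords] by blast
qed

end

section \<open>Comparison of the families of subgroups\<close>

theorem theorem5p12:
  fixes G :: "('a, 'c) monoid_scheme" and H :: "'a set" and \<D> :: "'a set set" and p :: nat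
  assumes "group G" and "finite (carrier G)"
    and "subgroup H G"
    and "admissible G \<D>"
    and "Factorial_Ring.prime p" and "p dvd card (rcosets\<^bsub>G\<^esub> H)"
  shows "primary_part (sha2 G \<D> (J G H) (J_act G)) p =
           primary_part (sha2 G (family_at_prime G H p \<D>) (J G H) (J_act G)) p
       \<and> primary_part (sha2_omega G (J G H) (J_act G)) p =
           primary_part (sha2 G (cyclic_p_subgroups (G\<lparr>carrier := H\<rparr>) p) (J G H) (J_act G)) p"
proof -
  interpret group G by fact
  note fin = assms(2) and H = assms(3) and p = assms(5)
  interpret JM: G_module G "J G H" "J_act G" by (rule J_module[OF H])
  have \<D>: "\<And>D. D \<in> \<D> \<Longrightarrow> subgroup D G" and cyc: "cyclic_subgroups G \<subseteq> \<D>"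
    using assms(4) by (auto simp: admissible_def)
  have fam: "family_at G H \<D> \<subseteq> \<D>"
    using cyc cyclic_subgroups_of_subgroup[OF H] by (auto simp: family_at_def)
  have fam_p: "\<exists>D\<in>\<D>. P \<subseteq> D \<and> subgroup P G" if "P \<in> family_at_prime G H p \<D>" for P
  proof -
    obtain D where D: "D \<in> family_at G H \<D>" "subgroup P (G\<lparr>carrier := D\<rparr>)"
      using \<open>P \<in> _\<close> by (auto simp: family_at_prime_def sylow_subgroups_def)
    moreover have "subgroup D G" using D(1) fam \<D> by blast
    ultimately show ?thesis using fam incl_subgroup[of D P] subgroup.subset[OF D(2)] by auto
  qed
  have cyc_p: "cyclic_p_subgroups (G\<lparr>carrier := H\<rparr>) p \<subseteq> cyclic_subgroups G"
    using cyclic_subgroups_of_subgroup[OF H] by (auto simp: cyclic_p_subgroups_def)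
  \<comment> \<open>A cyclic \<open>p\<close>-subgroup of \<open>H\<close> belongs to
    \<open>family_at\<close> and is its own \<open>p\<close>-Sylow subgroup.\<close>
  have cyc_fam: "cyclic_p_subgroups (G\<lparr>carrier := H\<rparr>) p \<subseteq> family_at_prime G H p \<D>"
  proof
    fix K assume K: "K \<in> cyclic_p_subgroups (G\<lparr>carrier := H\<rparr>) p"
    then obtain n where "card K = p ^ n" by (auto simp: cyclic_p_subgroups_def)
    moreover have "subgroup K G" using K cyc_p by (auto simp: cyclic_subgroups_def)
    then have "subgroup K (G\<lparr>carrier := K\<rparr>)" by (simp add: subgroup_incl)
    ultimately have "K \<in> sylow_subgroups p (G\<lparr>carrier := K\<rparr>)"
      using p by (simp add: sylow_subgroups_def order_def)
    moreover have "K \<in> family_at G H \<D>" using K by (simp add: cyclic_p_subgroups_def family_at_def)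
    ultimately show "K \<in> family_at_prime G H p \<D>" unfolding family_at_prime_def by blast
  qed
  have sub: "splits (G\<lparr>carrier := P\<rparr>) (J G H) (J_act G) z"
    if "splits (G\<lparr>carrier := D\<rparr>) (J G H) (J_act G) z" "P \<subseteq> D" for P D z
    using splits_mono[OF that(1), of P] that(2) by simp
  have "primary_part (sha2 G \<D> (J G H) (J_act G)) p =
      primary_part (sha2 G (family_at_prime G H p \<D>) (J G H) (J_act G)) p"
  proof (rule JM.primary_sha2_eqI[OF \<D>])
    fix P assume "P \<in> family_at_prime G H p \<D>"
    then show "subgroup P G" using fam_p by blast
  next
    fix z n
    assume z: "factor_set G (J G H) (J_act G) z"
      and pn: "splits G (J G H) (J_act G) (\<lambda>x. z x [^]\<^bsub>J G H\<^esub> (p ^ n))"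
    show "(\<forall>D\<in>\<D>. splits (G\<lparr>carrier := D\<rparr>) (J G H) (J_act G) z) \<longleftrightarrow>
      (\<forall>D\<in>family_at_prime G H p \<D>. splits (G\<lparr>carrier := D\<rparr>) (J G H) (J_act G) z)"
    proof
      assume "\<forall>D\<in>\<D>. splits (G\<lparr>carrier := D\<rparr>) (J G H) (J_act G) z"
      then show "\<forall>D\<in>family_at_prime G H p \<D>. splits (G\<lparr>carrier := D\<rparr>) (J G H) (J_act G) z"
        using fam_p sub by meson
    next
      assume *: "\<forall>D\<in>family_at_prime G H p \<D>. splits (G\<lparr>carrier := D\<rparr>) (J G H) (J_act G) z"
      show "\<forall>D\<in>\<D>. splits (G\<lparr>carrier := D\<rparr>) (J G H) (J_act G) z"
      proof
        fix D assume D: "D \<in> \<D>"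
        show "splits (G\<lparr>carrier := D\<rparr>) (J G H) (J_act G) z"
        \<comment> \<open>The cases follow the definition of \<open>family_at\<close>: cyclic
          members of \<open>\<D>\<close> are controlled through \<open>H\<close>, while any other
          member still belongs to the family, so that its Sylow subgroups are available.\<close>
        proof (cases "D \<in> cyclic_subgroups G")
          case True
          then show ?thesis using splits_J_cyclic[OF fin H p z pn] * cyc_fam by blast
        next
          case False
          have "finite D" using subgroup.subset[OF \<D>[OF D]] fin by (rule finite_subset)
          moreover obtain m where "order (G\<lparr>carrier := D\<rparr>) = p ^ multiplicity p (order (G\<lparr>carrier := D\<rparr>)) * m"
            using multiplicity_dvd by blast
          ultimately obtain P where P: "P \<in> sylow_subgroups p (G\<lparr>carrier := D\<rparr>)"
            using sylow_thm[OF p subgroup_imp_group[OF \<D>[OF D]]] by (auto simp: sylow_subgroups_def)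
          then have "P \<in> family_at_prime G H p \<D>"
            using D False by (auto simp: family_at_prime_def family_at_def)
          then show ?thesis
            using JM.splits_subgroup_of_splits_sylow[OF fin p z pn \<D>[OF D] P] * by blast
        qed
      qed
    qed
  qed
  \<comment> \<open>Not deduced from the first equality: \<open>splits_J_cyclic\<close> gives one
    direction directly, and the other holds because cyclic subgroups of \<open>H\<close> are cyclic
    subgroups of \<open>G\<close>.\<close>
  moreover have "primary_part (sha2_omega G (J G H) (J_act G)) p =
      primary_part (sha2 G (cyclic_p_subgroups (G\<lparr>carrier := H\<rparr>) p) (J G H) (J_act G)) p"
    unfolding sha2_omega_def
  proof (rule JM.primary_sha2_eqI)
    fix z n
    assume z: "factor_set G (J G H) (J_act G) z"
      and pn: "splits G (J G H) (J_act G) (\<lambda>x. z x [^]\<^bsub>J G H\<^esub> (p ^ n))"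
    show "(\<forall>D\<in>cyclic_subgroups G. splits (G\<lparr>carrier := D\<rparr>) (J G H) (J_act G) z) \<longleftrightarrow>
      (\<forall>D\<in>cyclic_p_subgroups (G\<lparr>carrier := H\<rparr>) p. splits (G\<lparr>carrier := D\<rparr>) (J G H) (J_act G) z)"
      using splits_J_cyclic[OF fin H p z pn] cyc_p by blast
  qed (use cyc_p in \<open>auto simp: cyclic_subgroups_def\<close>)
  ultimately show ?thesis by blast
qed

end
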